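(* Let $T>0$ and let $\lambda,\mu:[0,T]\to[0,\infty)$ be smooth functions. Consider a broadcaster $u$ whose messages are posted according to an inhomogeneous Poisson process with intensity $\lambda(t)$, and a follower $v$ of $u$ whose feed receives messages from all other broadcasters according to an independent inhomogeneous Poisson process with intensity $\mu(t)$. For each integer $k\ge 1$ and $t\in[0,T]$ let $f_k(t)$ be the probability that at least one message from the broadcaster $u$ is among the $k$ most recent messages received by the follower $v$ at time $t$. Under the boundary conditions $f_1(0)=\dots=f_k(0)=0$, the probability $f_k(t)$ is uniquely determined and is given, for all $t\in[0,T]$, by $$ f_k(t)=\frac{1}{(k-1)!}\int_0^t \lambda(\tau)\, e^{-\int_\tau^t \lambda(x)\,dx}\;\Gamma\!\left[k,\int_\tau^t\mu(x)\,dx\right]d\tau, $$ where $\Gamma[k,x]=\int_x^\infty s^{k-1}e^{-s}\,ds$ is the (upper) incomplete Gamma function.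
   Context: The follower's feed is a list of received messages in inverse chronological order (most recent first). The feed of $v$ receives every message posted by $u$ and every message posted by the other broadcasters $v$ follows; each newly arriving message takes rank 1 and shifts every earlier message down by one rank. The feed is assumed full at the start. The rank $r(t)$ is the smallest position in the feed at time $t$ occupied by a message of $u$ (with $r(t)=\infty$ if there is none), and $f_k(t)=\mathbb P\{r(t)\le k\}$. The boundary conditions $f_1(0)=\dots=f_k(0)=0$ mean that at time $0$ none of the $k$ most recent messages in the feed is from $u$, i.e. they all come from other broadcasters. An inhomogeneous Poisson process with intensity $\lambda(t)$ has an event in $[t,t+dt)$ with probability $\lambda(t)\,dt$, independently over disjoint time intervals. *)

theory Defs
  imports "HOL-Probability.Probability"
begin

text \<open>
  \<open>D n\<close> is the \<open>n\<close>-th derivative of \<open>f\<close>, one-sided at the boundary points of an interval.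
\<close>
definition smooth_on :: "real set \<Rightarrow> (real \<Rightarrow> real) \<Rightarrow> bool" where
  "smooth_on S f \<longleftrightarrow>
     (\<exists>D :: nat \<Rightarrow> real \<Rightarrow> real. (\<forall>x\<in>S. D 0 x = f x) \<and>
        (\<forall>n. \<forall>x\<in>S. (D n has_real_derivative D (Suc n) x) (at x within S)))"

definition upper_Gamma :: "nat \<Rightarrow> real \<Rightarrow> real" where
  "upper_Gamma k x = integral {x..} (\<lambda>s. s ^ (k - 1) * exp (- s))"

definition events_in :: "('a \<Rightarrow> real set) \<Rightarrow> real \<times> real \<Rightarrow> 'a \<Rightarrow> nat" where
  "events_in E = (\<lambda>(a, b) \<omega>. card (E \<omega> \<inter> {a..<b}))"

text \<open>
  A process is given by its random set of event times. Windows are half open, of the form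
  \<open>[t, t + h)\<close>; this rules out events at a deterministic time \<open>t < T\<close>.
\<close>
locale inhomogeneous_poisson_process = prob_space M
  for M :: "'a measure" and T :: real and rate :: "real \<Rightarrow> real" and E :: "'a \<Rightarrow> real set" +
  assumes finite_events: "\<And>\<omega>. \<omega> \<in> space M \<Longrightarrow> finite (E \<omega>) \<and> E \<omega> \<subseteq> {0..T}"
    and random_variable_events_in:
      "\<And>I. random_variable (count_space UNIV) (events_in E I)"
    and independent_increments:
      "\<And>J. J \<subseteq> {(a, b). 0 \<le> a \<and> a < b \<and> b \<le> T} \<Longrightarrow>
         disjoint_family_on (\<lambda>(a, b). {a..<b}) J \<Longrightarrow>
         indep_vars (\<lambda>_. count_space UNIV) (events_in E) J"
    and one_event:
      "\<And>t. 0 \<le> t \<Longrightarrow> t < T \<Longrightarrow>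
         (\<lambda>h. \<P>(\<omega> in M. events_in E (t, t + h) \<omega> = 1) - rate t * h) \<in> o[at_right 0](\<lambda>h. h)"
    and several_events:
      "\<And>t. 0 \<le> t \<Longrightarrow> t < T \<Longrightarrow>
         (\<lambda>h. \<P>(\<omega> in M. events_in E (t, t + h) \<omega> \<ge> 2)) \<in> o[at_right 0](\<lambda>h. h)"

datatype sender = Broadcaster | Other

text \<open>
  \<open>U\<close> and \<open>V\<close> are the posting times of the broadcaster and of all other broadcasters the follower
  follows. Simultaneous messages (an event of probability zero in the model below) are both
  received; their relative order is an arbitrary choice.
\<close>
definition received :: "real set \<Rightarrow> real set \<Rightarrow> real \<Rightarrow> sender list" where
  "received U V t =
     concat (map (\<lambda>s. (if s \<in> U then [Broadcaster] else []) @ (if s \<in> V then [Other] else []))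
       (rev (sorted_list_of_set ((U \<union> V) \<inter> {0..<t}))))"

text \<open>
  The most recent message comes first. A full feed is an infinite stream; \<open>F\<close> is the feed at
  time \<open>0\<close>, shifted down by the messages that arrived during \<open>[0, t)\<close>.
\<close>
definition feed :: "real set \<Rightarrow> real set \<Rightarrow> sender stream \<Rightarrow> real \<Rightarrow> sender stream" where
  "feed U V F t = received U V t @- F"

definition rank :: "sender stream \<Rightarrow> enat" where
  "rank s = Inf {enat i | i. 1 \<le> i \<and> s !! (i - 1) = Broadcaster}"

lemma rank_le_iff: "rank s \<le> enat k \<longleftrightarrow> Broadcaster \<in> set (stake k s)"
proof
  assume "rank s \<le> enat k"
  then have "rank s < enat (Suc k)"
    by (rule order.strict_trans1) simp
  then obtain i where "1 \<le> i" "s !! (i - 1) = Broadcaster" "i \<le> k"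
    unfolding rank_def Inf_less_iff by auto
  then have "i - 1 < length (stake k s)" "stake k s ! (i - 1) = Broadcaster"
    by (simp_all add: stake_nth)
  then show "Broadcaster \<in> set (stake k s)"
    by (metis nth_mem)
next
  assume "Broadcaster \<in> set (stake k s)"
  then obtain i where "i < k" "s !! i = Broadcaster"
    by (auto simp: in_set_conv_nth stake_nth)
  then have "rank s \<le> enat (Suc i)"
    unfolding rank_def by (intro Inf_lower) force
  also have "\<dots> \<le> enat k"
    using \<open>i < k\<close> by simp
  finally show "rank s \<le> enat k" .
qed

definition visibility ::
  "'a measure \<Rightarrow> ('a \<Rightarrow> real set) \<Rightarrow> ('a \<Rightarrow> real set) \<Rightarrow> ('a \<Rightarrow> sender stream) \<Rightarrow>
     nat \<Rightarrow> real \<Rightarrow> real" where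
  "visibility M U V F k t = \<P>(\<omega> in M. rank (feed (U \<omega>) (V \<omega>) (F \<omega>) t) \<le> enat k)"

text \<open>
  Independence of the two processes is independence of the families of all their counts. The
  initial feed may be random and may depend on both processes.
\<close>
locale follower_feed = prob_space M
  for M :: "'a measure" and T :: real and rateU rateV :: "real \<Rightarrow> real"
    and U V :: "'a \<Rightarrow> real set" and F :: "'a \<Rightarrow> sender stream" +
  assumes broadcaster: "inhomogeneous_poisson_process M T rateU U"
    and others: "inhomogeneous_poisson_process M T rateV V"
    and independent:
      "indep_var (\<Pi>\<^sub>M I\<in>UNIV. count_space UNIV) (\<lambda>\<omega> I. events_in U I \<omega>)
                 (\<Pi>\<^sub>M I\<in>UNIV. count_space UNIV) (\<lambda>\<omega> I. events_in V I \<omega>)"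
    and initial_feed: "random_variable (stream_space (count_space UNIV)) F"

end

theory Submission
  imports Defs
begin

text \<open>
  Almost surely the initial feed contributes nothing to the top \<open>k\<close>, so \<open>f\<^sub>k(t)\<close> is the
  probability that a broadcaster message is followed by fewer than \<open>k\<close> other messages before time
  \<open>t\<close>. Conditioning on the window \<open>[t, t + h)\<close>, which is independent of the past, gives the right
  derivative \<open>f\<^sub>k' = \<lambda> (1 - f\<^sub>k) + \<mu> (f\<^bsub>k-1\<^esub> - f\<^sub>k)\<close> with \<open>f\<^sub>0 = 0\<close>. The rates are known only through
  limits from the right, but \<open>f\<^sub>k\<close> is left continuous because the events are finitely many, and a
  left continuous function with vanishing right derivative is constant. Expanding
  \<open>\<Gamma>[k, x] = (k-1)! e\<^sup>-\<^sup>x (\<Sum>j<k. x\<^sup>j / j!)\<close> and multiplying by the integrating factor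
  \<open>exp (\<integral>\<^sub>0\<^sup>t (\<lambda> + \<mu>))\<close>, the claimed formula satisfies the same equations, and induction on \<open>k\<close>
  shows that the difference vanishes.
\<close>

subsection \<open>Real analysis\<close>

text \<open>Continuous induction: for each \<open>e > 0\<close> the bound
  \<open>\<bar>f y - f a\<bar> \<le> e * (y - a)\<close> holds up to a largest point. Left
  continuity includes that point, and the right derivative there carries the bound further unless
  the point is \<open>b\<close>. As \<open>e\<close> is arbitrary, equality follows.\<close>

lemma constant_if_right_derivative_zero:
  fixes f :: "real \<Rightarrow> real"
  assumes "a \<le> b"
    and left: "\<And>x. a < x \<Longrightarrow> x \<le> b \<Longrightarrow> (f \<longlongrightarrow> f x) (at_left x)"
    and right: "\<And>x. a \<le> x \<Longrightarrow> x < b \<Longrightarrow> (f has_real_derivative 0) (at_right x)"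
  shows "f b = f a"
proof -
  have bound: "\<bar>f b - f a\<bar> \<le> e * (b - a)" if "e > 0" for e
  proof -
    define S where "S = {x \<in> {a..b}. \<forall>y\<in>{a..x}. \<bar>f y - f a\<bar> \<le> e * (y - a)}"
    define c where "c = Sup S"
    have "a \<in> S"
      using \<open>a \<le> b\<close> by (auto simp: S_def)
    have bdd: "bdd_above S"
      unfolding S_def by (rule bdd_aboveI[of _ b]) auto
    have "a \<le> c"
      unfolding c_def by (rule cSup_upper[OF \<open>a \<in> S\<close> bdd])
    have "c \<le> b"
      unfolding c_def using \<open>a \<in> S\<close> by (intro cSup_least) (auto simp: S_def)
    have below: "\<bar>f y - f a\<bar> \<le> e * (y - a)" if y: "a \<le> y" "y < c" for y
    proof -
      obtain x where "x \<in> S" "y < x"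
        using y less_cSup_iff[OF _ bdd, of y] \<open>a \<in> S\<close> unfolding c_def by auto
      then show ?thesis
        using y by (auto simp: S_def)
    qed
    have at_c: "\<bar>f c - f a\<bar> \<le> e * (c - a)"
    proof (cases "c = a")
      case False
      then have "a < c"
        using \<open>a \<le> c\<close> by simp
      have "((\<lambda>y. \<bar>f y - f a\<bar>) \<longlongrightarrow> \<bar>f c - f a\<bar>) (at_left c)"
        using left[OF \<open>a < c\<close> \<open>c \<le> b\<close>] by (intro tendsto_intros)
      moreover have "((\<lambda>y. e * (y - a)) \<longlongrightarrow> e * (c - a)) (at_left c)"
        by (intro tendsto_intros)
      moreover have "\<forall>\<^sub>F y in at_left c. \<bar>f y - f a\<bar> \<le> e * (y - a)"
        using eventually_at_left_real[OF \<open>a < c\<close>] by eventually_elim (auto intro: below)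
      ultimately show ?thesis
        by (intro tendsto_le[of "at_left c"]) auto
    qed simp
    have "c = b"
    proof (rule ccontr)
      assume "c \<noteq> b"
      with \<open>c \<le> b\<close> have "c < b" by simp
      have "((\<lambda>y. (f y - f c) / (y - c)) \<longlongrightarrow> 0) (at_right c)"
        using right[OF \<open>a \<le> c\<close> \<open>c < b\<close>] by (simp add: has_field_derivative_iff)
      from tendstoD[OF this \<open>e > 0\<close>]
      have "\<forall>\<^sub>F y in at_right c. \<bar>f y - f c\<bar> \<le> e * (y - c)"
        using eventually_at_right_less[of c]
        by eventually_elim (auto simp: dist_real_def field_simps)
      then obtain d where d: "c < d" "\<And>y. c < y \<Longrightarrow> y < d \<Longrightarrow> \<bar>f y - f c\<bar> \<le> e * (y - c)"
        unfolding eventually_at_right_field by blast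
      \<comment> \<open>A point strictly to the right of \<open>c\<close>, within the reach
        \<open>d\<close> of the derivative estimate and still in \<open>{a..b}\<close>; its
        membership in \<open>S\<close> contradicts the supremum.\<close>
      define x where "x = min b ((c + d) / 2)"
      have x: "c < x" "x \<le> b" "x < d"
        using \<open>c < b\<close> d(1) by (auto simp: x_def min_def)
      have "\<bar>f y - f a\<bar> \<le> e * (y - a)" if "a \<le> y" "y \<le> x" for y
      proof -
        consider "y < c" | "y = c" | "c < y" by linarith
        then show ?thesis
        proof cases
          case 3
          have "\<bar>f y - f a\<bar> \<le> \<bar>f y - f c\<bar> + \<bar>f c - f a\<bar>" by simp
          also have "\<dots> \<le> e * (y - c) + e * (c - a)"
            using d(2)[of y] 3 that x at_c by (intro add_mono) auto
          finally show ?thesis by (simp add: algebra_simps)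
        qed (use below at_c that in auto)
      qed
      then have "x \<in> S"
        using x \<open>a \<le> c\<close> by (auto simp: S_def)
      then have "x \<le> c"
        unfolding c_def by (rule cSup_upper[OF _ bdd])
      with x show False by simp
    qed
    with at_c show ?thesis by simp
  qed
  have "\<bar>f b - f a\<bar> \<le> 0"
  proof (cases "a = b")
    case False
    with \<open>a \<le> b\<close> have "b - a > 0" by simp
    show ?thesis
    proof (rule field_le_epsilon)
      fix e :: real assume "e > 0"
      then show "\<bar>f b - f a\<bar> \<le> 0 + e"
        using bound[of "e / (b - a)"] \<open>b - a > 0\<close> by simp
    qed
  qed simp
  then show ?thesis by simp
qed

text \<open>Repeated integration by parts gives an explicit antiderivative that vanishes at
  infinity. The incomplete Gamma function thus becomes a finite sum, one term per rank, which suits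
  induction on \<open>k\<close>.\<close>

lemma upper_Gamma_eq:
  assumes "x \<ge> 0" "k \<ge> 1"
  shows "upper_Gamma k x = fact (k - 1) * exp (- x) * (\<Sum>j<k. x ^ j / fact j)"
proof -
  \<comment> \<open>\<open>H n\<close> is minus the expected closed form for
    \<open>k = Suc n\<close>, hence an antiderivative of \<open>s ^ n * exp (- s)\<close>.\<close>
  define H where "H n s = - (fact n * exp (- s) * (\<Sum>j<Suc n. s ^ j / fact j))" for n and s :: real
  have deriv: "(H n has_real_derivative s ^ n * exp (- s)) (at s)" for n s
  proof (induction n)
    case 0
    show ?case
      unfolding H_def by (auto intro!: derivative_eq_intros)
  next
    case (Suc n)
    \<comment> \<open>The recursion is one integration by parts; when it is differentiated, the two
      terms \<open>real (Suc n) * s ^ n * exp (- s)\<close> cancel.\<close>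
    have H_Suc: "H (Suc n) = (\<lambda>s. real (Suc n) * H n s - s ^ Suc n * exp (- s))"
    proof
      fix s :: real
      define S where "S = (\<Sum>j<Suc n. s ^ j / fact j)"
      have "H (Suc n) s = - (fact (Suc n) * exp (- s) * (S + s ^ Suc n / fact (Suc n)))"
        by (simp add: H_def S_def)
      also have "\<dots> = - (fact (Suc n) * exp (- s) * S) - s ^ Suc n * exp (- s)"
        by (simp add: distrib_left del: fact_Suc power_Suc)
      finally show "H (Suc n) s = real (Suc n) * H n s - s ^ Suc n * exp (- s)"
        unfolding H_def S_def[symmetric] by (simp add: algebra_simps)
    qed
    show ?case
      unfolding H_Suc by (auto intro!: derivative_eq_intros Suc simp del: power_Suc)
  qed
  have lim: "(H n \<longlongrightarrow> 0) at_top" for n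
  proof -
    have "((\<lambda>s :: real. (s ^ j / exp s) / fact j) \<longlongrightarrow> 0) at_top" for j
      using tendsto_divide[OF tendsto_power_div_exp_0[of j] tendsto_const[of "fact j"]] by simp
    then have "((\<lambda>s :: real. - (fact n * (\<Sum>j<Suc n. (s ^ j / exp s) / fact j))) \<longlongrightarrow> - (fact n * (\<Sum>j<Suc n. 0))) at_top"
      by (intro tendsto_minus tendsto_mult_left tendsto_sum)
    moreover have "(\<lambda>s. - (fact n * (\<Sum>j<Suc n. (s ^ j / exp s) / fact j))) = H n"
      by (rule ext) (simp add: H_def exp_minus sum_distrib_left sum_distrib_right field_simps del: sum.lessThan_Suc)
    ultimately show ?thesis by simp
  qed
  obtain n where n: "k = Suc n"
    using \<open>k \<ge> 1\<close> by (cases k) auto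
  \<comment> \<open>Extending the integrand by zero links the nonnegative Lebesgue integral, where
    the half-line fundamental theorem applies, to the gauge integral in
    \<open>upper_Gamma\<close>.\<close>
  define g where "g s = (if s \<in> {x..} then s ^ n * exp (- s) else 0)" for s :: real
  have [measurable]: "g \<in> borel_measurable borel"
    unfolding g_def by measurable
  have "(\<integral>\<^sup>+s. ennreal (s ^ n * exp (- s)) * indicator {x..} s \<partial>lborel) = ennreal (0 - H n x)"
    using \<open>x \<ge> 0\<close> by (intro nn_integral_FTC_atLeast deriv lim) auto
  also have "(\<integral>\<^sup>+s. ennreal (s ^ n * exp (- s)) * indicator {x..} s \<partial>lborel) = (\<integral>\<^sup>+s. ennreal (g s) \<partial>lborel)"
    by (intro nn_integral_cong) (auto simp: g_def indicator_def)
  finally have "(g has_integral - H n x) UNIV"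
    using \<open>x \<ge> 0\<close>
    by (intro nn_integral_has_integral)
      (measurable, auto simp: g_def H_def intro!: mult_nonneg_nonneg sum_nonneg simp del: sum.lessThan_Suc)
  then have "((\<lambda>s. s ^ n * exp (- s)) has_integral - H n x) {x..}"
    unfolding g_def by (rule has_integral_restrict_UNIV[THEN iffD1])
  then show ?thesis
    unfolding upper_Gamma_def n by (simp add: integral_unique H_def del: sum.lessThan_Suc)
qed

text \<open>The variable \<open>t\<close> occurs in the upper limit and in the integrand. Splitting
  off one factor \<open>Mu t - Mu \<tau>\<close> moves \<open>t\<close> outside, so the product rule
  and induction on the exponent suffice. The weight \<open>w\<close> is arbitrary in the induction
  because it absorbs the factor \<open>Mu \<tau>\<close>.\<close>

lemma has_real_derivative_integral_power:
  fixes w m Mu :: "real \<Rightarrow> real"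
  assumes w: "continuous_on {0..T} w" and Mu: "\<And>t. t \<in> {0..T} \<Longrightarrow> (Mu has_real_derivative m t) (at t within {0..T})"
    and t: "t \<in> {0..T}"
  shows "((\<lambda>t. integral {0..t} (\<lambda>\<tau>. w \<tau> * (Mu t - Mu \<tau>) ^ j)) has_real_derivative
      (if j = 0 then w t else real j * m t * integral {0..t} (\<lambda>\<tau>. w \<tau> * (Mu t - Mu \<tau>) ^ (j - 1))))
    (at t within {0..T})"
  using w
proof (induction j arbitrary: w)
  case 0
  then show ?case
    using integral_has_real_derivative[OF 0 t] by simp
next
  case (Suc j)
  have Mu_cont: "continuous_on {0..T} Mu"
    using Mu by (meson DERIV_continuous continuous_on_eq_continuous_within)
  have integrable: "(\<lambda>\<tau>. v \<tau> * (Mu s - Mu \<tau>) ^ i) integrable_on {0..s}"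
    if "continuous_on {0..T} v" "s \<in> {0..T}" for v s i
    using that
    by (intro integrable_continuous_real continuous_intros continuous_on_subset[OF that(1)]
        continuous_on_subset[OF Mu_cont]) auto
  have wMu: "continuous_on {0..T} (\<lambda>\<tau>. w \<tau> * Mu \<tau>)"
    by (intro continuous_intros Suc.prems Mu_cont)
  define I where "I v i s = integral {0..s} (\<lambda>\<tau>. v \<tau> * (Mu s - Mu \<tau>) ^ i)" for v i s
  have I_Suc: "I w (Suc i) s = Mu s * I w i s - I (\<lambda>\<tau>. w \<tau> * Mu \<tau>) i s" if "s \<in> {0..T}" for i s
  proof -
    have "I w (Suc i) s =
        integral {0..s} (\<lambda>\<tau>. Mu s * (w \<tau> * (Mu s - Mu \<tau>) ^ i) - w \<tau> * Mu \<tau> * (Mu s - Mu \<tau>) ^ i)"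
      unfolding I_def by (intro integral_cong) (simp add: algebra_simps)
    also have "\<dots> = Mu s * I w i s - I (\<lambda>\<tau>. w \<tau> * Mu \<tau>) i s"
      unfolding I_def
      using integrable[OF Suc.prems that, of i] integrable[OF wMu that, of i]
      by (subst integral_diff) (auto intro: integrable_on_mult_right)
    finally show ?thesis .
  qed
  note IH = Suc.IH[OF Suc.prems, folded I_def] Suc.IH[OF wMu, folded I_def]
  \<comment> \<open>For \<open>j = 0\<close> the boundary terms \<open>Mu t * w t\<close> cancel.
    For \<open>j = Suc i\<close> the two lower-order integrals recombine by \<open>I_Suc\<close>
    into \<open>real j * m t * I w j t\<close>, which joins the term
    \<open>m t * I w j t\<close>.\<close>
  have "((\<lambda>s. Mu s * I w j s - I (\<lambda>\<tau>. w \<tau> * Mu \<tau>) j s) has_real_derivative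
      real (Suc j) * m t * I w j t) (at t within {0..T})"
  proof (cases j)
    case 0
    then show ?thesis
      using IH by (auto intro!: derivative_eq_intros Mu t)
  next
    case (Suc i)
    then show ?thesis
      using IH by (auto intro!: derivative_eq_intros Mu t) (simp add: I_Suc[OF t] algebra_simps)
  qed
  then have "(I w (Suc j) has_real_derivative real (Suc j) * m t * I w j t) (at t within {0..T})"
    by (rule has_field_derivative_transform_within[OF _ zero_less_one t]) (simp add: I_Suc)
  then show ?case
    unfolding I_def by simp
qed

subsection \<open>Visibility along a single feed\<close>

lemma UNIV_sender: "UNIV = {Broadcaster, Other}"
  using sender.exhaust by auto

text \<open>
  Among the messages of \<open>[0, t)\<close>, one at time \<open>s\<close> is in the top \<open>k\<close> iff fewer than \<open>k\<close>
  messages came later. Later messages of the broadcaster need not be counted: the latest broadcaster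
  message witnesses the same event.
\<close>
definition visible :: "real set \<Rightarrow> real set \<Rightarrow> nat \<Rightarrow> real \<Rightarrow> bool" where
  "visible U V k t \<longleftrightarrow> (\<exists>s\<in>U \<inter> {0..<t}. card (V \<inter> {s<..<t}) < k)"

lemma visible_nonpos: "t \<le> 0 \<Longrightarrow> \<not> visible A B k t"
  by (auto simp: visible_def)

text \<open>Induction from the most recent time: a newest time in \<open>U\<close> puts a
  broadcaster message at rank 1, while a newest time only in \<open>V\<close> uses up one of the
  \<open>k\<close> ranks.\<close>

lemma Broadcaster_in_take_concat_iff:
  fixes ts :: "'a :: linorder list"
  assumes "sorted_wrt (>) ts"
  shows "Broadcaster \<in> set (take k (concat (map (\<lambda>s. (if s \<in> U then [Broadcaster] else []) @
            (if s \<in> V then [Other] else [])) ts))) \<longleftrightarrow>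
          (\<exists>s\<in>set ts \<inter> U. card (V \<inter> {y \<in> set ts. s < y}) < k)"
  using assms
proof (induction ts arbitrary: k)
  case Nil
  then show ?case by simp
next
  case (Cons x ts)
  have below: "y < x" if "y \<in> set ts" for y
    using Cons.prems that by auto
  have "x \<notin> set ts"
    using below[of x] by auto
  have IH: "Broadcaster \<in> set (take k (concat (map (\<lambda>s. (if s \<in> U then [Broadcaster] else []) @
            (if s \<in> V then [Other] else [])) ts))) \<longleftrightarrow>
          (\<exists>s\<in>set ts \<inter> U. card (V \<inter> {y \<in> set ts. s < y}) < k)" for k
    using Cons.prems by (intro Cons.IH) simp
  have above: "V \<inter> {y \<in> set (x # ts). s < y} =
      (if x \<in> V then insert x (V \<inter> {y \<in> set ts. s < y}) else V \<inter> {y \<in> set ts. s < y})"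
    if "s \<in> set ts" for s
    using below[OF that] by auto
  have card: "card (V \<inter> {y \<in> set (x # ts). s < y}) = (if x \<in> V then 1 else 0) + card (V \<inter> {y \<in> set ts. s < y})"
    if "s \<in> set ts" for s
    unfolding above[OF that] using \<open>x \<notin> set ts\<close> by (simp add: card_insert_if)
  have max: "V \<inter> {y \<in> set (x # ts). x < y} = {}"
    using below by (auto dest: less_asym)
  show ?case
  proof (cases "x \<in> U")
    case True
    then show ?thesis
      using max by (cases k) auto
  next
    case False
    have "(\<exists>s\<in>set (x # ts) \<inter> U. card (V \<inter> {y \<in> set (x # ts). s < y}) < k) \<longleftrightarrow>
        (\<exists>s\<in>set ts \<inter> U. card (V \<inter> {y \<in> set ts. s < y}) < k - (if x \<in> V then 1 else 0))"
    proof (rule bex_cong)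
      show "set (x # ts) \<inter> U = set ts \<inter> U"
        using False by simp
    qed (auto simp: card less_diff_conv simp del: set_simps)
    then show ?thesis
      unfolding IH[symmetric] using False by (simp add: take_Cons')
  qed
qed

text \<open>This length is the number of ranks by which the initial feed is pushed down.\<close>

lemma length_concat_senders:
  assumes "distinct ts"
  shows "length (concat (map (\<lambda>s. (if s \<in> U then [Broadcaster] else []) @
            (if s \<in> V then [Other] else [])) ts)) = card (U \<inter> set ts) + card (V \<inter> set ts)"
  using assms
proof (induction ts)
  case (Cons x ts)
  have "card (W \<inter> set (x # ts)) = (if x \<in> W then 1 else 0) + card (W \<inter> set ts)" for W
    using Cons.prems by (auto simp: card_insert_if Int_insert_right)
  then show ?case
    using Cons by simp
qed simp

lemma
  assumes "finite U" "finite V"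
  shows Broadcaster_in_take_received_iff: "Broadcaster \<in> set (take k (received U V t)) \<longleftrightarrow> visible U V k t"
    and length_received: "length (received U V t) = card (U \<inter> {0..<t}) + card (V \<inter> {0..<t})"
proof -
  define ts where "ts = rev (sorted_list_of_set ((U \<union> V) \<inter> {0..<t}))"
  have set_ts: "set ts = (U \<union> V) \<inter> {0..<t}"
    using assms by (simp add: ts_def)
  have "sorted_wrt (>) ts" "distinct ts"
    by (simp_all add: ts_def sorted_wrt_rev)
  have "V \<inter> {y \<in> set ts. s < y} = V \<inter> {s<..<t}" if "s \<in> U \<inter> {0..<t}" for s
    unfolding set_ts using that by auto
  moreover have "set ts \<inter> U = U \<inter> {0..<t}"
    unfolding set_ts by auto
  ultimately show "Broadcaster \<in> set (take k (received U V t)) \<longleftrightarrow> visible U V k t"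
    unfolding received_def ts_def[symmetric] visible_def
      Broadcaster_in_take_concat_iff[OF \<open>sorted_wrt (>) ts\<close>] by auto
  have "U \<inter> set ts = U \<inter> {0..<t}" "V \<inter> set ts = V \<inter> {0..<t}"
    unfolding set_ts by auto
  then show "length (received U V t) = card (U \<inter> {0..<t}) + card (V \<inter> {0..<t})"
    unfolding received_def ts_def[symmetric] length_concat_senders[OF \<open>distinct ts\<close>] by simp
qed

text \<open>The received messages fill the top ranks and leave the rest of the \<open>k\<close>
  ranks to the initial feed. The subtraction truncates at 0, and no rank is at most 0, so an initial
  feed pushed below rank \<open>k\<close> drops out.\<close>

lemma rank_feed_le_iff:
  assumes "finite U" "finite V"
  shows "rank (feed U V F t) \<le> enat k \<longleftrightarrow> visible U V k t \<or>
    rank F \<le> enat (k - (card (U \<inter> {0..<t}) + card (V \<inter> {0..<t})))"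
  unfolding rank_le_iff feed_def stake_shift
  using Broadcaster_in_take_received_iff[OF assms] length_received[OF assms] by simp

lemma card_Int_Ico_split:
  fixes a b c :: real
  assumes "finite A" "a \<le> b" "b \<le> c"
  shows "card (A \<inter> {a..<c}) = card (A \<inter> {a..<b}) + card (A \<inter> {b..<c})"
proof -
  have "A \<inter> {a..<c} = (A \<inter> {a..<b}) \<union> (A \<inter> {b..<c})"
    using assms by auto
  then show ?thesis
    using \<open>finite A\<close> by (simp add: card_Un_disjoint disjoint_iff)
qed

text \<open>Telescoping over adjacent cells; it recovers the count of a long window from the counts
  of disjoint cells, which are the independent quantities.\<close>

lemma sum_card_Int_Ico:
  fixes c :: "nat \<Rightarrow> real"
  assumes "finite A" "mono c" "m \<le> n"
  shows "(\<Sum>j\<in>{m..<n}. card (A \<inter> {c j..<c (Suc j)})) = card (A \<inter> {c m..<c n})"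
  using \<open>m \<le> n\<close>
proof (induction n rule: dec_induct)
  case (step n)
  then show ?case
    using card_Int_Ico_split[OF \<open>finite A\<close>, of "c m" "c n" "c (Suc n)"] monoD[OF \<open>mono c\<close>]
    by simp
qed simp

text \<open>Without a broadcaster message in the window, the others only push earlier messages down,
  so the budget \<open>k\<close> shrinks by their number. With broadcaster messages alone, nothing
  from \<open>V\<close> follows them, so a budget of 1 suffices.\<close>

lemma visible_step:
  assumes "finite U" "finite V" "0 \<le> t" "t \<le> s"
  shows visible_step_none: "U \<inter> {t..<s} = {} \<Longrightarrow>
          visible U V k s \<longleftrightarrow> visible U V (k - card (V \<inter> {t..<s})) t"
    and visible_step_broadcaster: "U \<inter> {t..<s} \<noteq> {} \<Longrightarrow> V \<inter> {t..<s} = {} \<Longrightarrow> k \<ge> 1 \<Longrightarrow> visible U V k s"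
proof -
  assume U: "U \<inter> {t..<s} = {}"
  have "card (V \<inter> {r<..<s}) = card (V \<inter> {r<..<t}) + card (V \<inter> {t..<s})" if "r < t" for r
  proof -
    have "V \<inter> {r<..<s} = (V \<inter> {r<..<t}) \<union> (V \<inter> {t..<s})"
      using \<open>t \<le> s\<close> \<open>r < t\<close> by auto
    then show ?thesis
      using \<open>finite V\<close> by (simp add: card_Un_disjoint disjoint_iff)
  qed
  moreover have "U \<inter> {0..<s} = U \<inter> {0..<t}"
    using U \<open>t \<le> s\<close> by force
  ultimately show "visible U V k s \<longleftrightarrow> visible U V (k - card (V \<inter> {t..<s})) t"
    unfolding visible_def by (auto simp: less_diff_conv)
next
  assume *: "U \<inter> {t..<s} \<noteq> {}" "V \<inter> {t..<s} = {}" "k \<ge> 1"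
  then obtain r where r: "r \<in> U" "t \<le> r" "r < s"
    by auto
  then have "V \<inter> {r<..<s} = {}"
    using *(2) by auto
  with r \<open>0 \<le> t\<close> \<open>k \<ge> 1\<close> show "visible U V k s"
    unfolding visible_def by (intro bexI[of _ r]) auto
qed

text \<open>Counting only from the end of the cell that contains \<open>s\<close> can miss messages
  of \<open>V\<close> that follow \<open>s\<close> in the same cell. Once the mesh is below the
  smallest gap between distinct times of \<open>U\<close> and \<open>V\<close>, there are
  none.\<close>

lemma eventually_visible_iff_cells:
  fixes t :: real
  assumes "finite U" "finite V" "t > 0"
  shows "\<forall>\<^sub>F n in sequentially. visible U V k t \<longleftrightarrow>
    (\<exists>i<n. U \<inter> {t * real i / real n..<t * real (Suc i) / real n} \<noteq> {} \<and>
       card (V \<inter> {t * real (Suc i) / real n..<t}) < k)"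
proof -
  \<comment> \<open>Pairs of equal times are removed: a simultaneous message does not count as
    later, and all remaining distances are positive.\<close>
  define D where "D = (\<lambda>(u, v). \<bar>u - v\<bar>) ` (U \<times> V - Id)"
  have "finite D" "\<forall>d\<in>D. d > 0"
    using assms by (auto simp: D_def)
  then obtain d where d: "d > 0" "\<forall>x\<in>D. d < x"
    using finite_less_Inf_iff by (metis dense empty_iff finite_less_Inf_iff gt_ex)
  have apart: "d < \<bar>u - v\<bar>" if "u \<in> U" "v \<in> V" "u \<noteq> v" for u v
  proof -
    have "\<bar>u - v\<bar> \<in> D"
      unfolding D_def by (rule image_eqI[of _ _ "(u, v)"]) (use that in auto)
    then show ?thesis using d(2) by blast
  qed
  have "(\<lambda>n. t / real n) \<longlonglongrightarrow> 0"
    by (rule lim_const_over_n)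
  from order_tendstoD(2)[OF this \<open>d > 0\<close>] eventually_gt_at_top[of 0] show ?thesis
  proof eventually_elim
    case (elim n)
    then have width: "t * real (Suc i) / real n < t * real i / real n + d" for i
      by (simp add: field_simps)
    show ?case
    proof
      assume "visible U V k t"
      then obtain s where s: "s \<in> U" "0 \<le> s" "s < t" "card (V \<inter> {s<..<t}) < k"
        by (auto simp: visible_def)
      \<comment> \<open>The index of the cell of width \<open>t / real n\<close> that contains
        \<open>s\<close>.\<close>
      define i where "i = nat \<lfloor>s * real n / t\<rfloor>"
      have i: "real i \<le> s * real n / t" "s * real n / t < real (Suc i)"
      proof -
        have "0 \<le> s * real n / t"
          using s \<open>t > 0\<close> by simp
        then have "real i = of_int \<lfloor>s * real n / t\<rfloor>"
          by (simp add: i_def)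
        then show "real i \<le> s * real n / t" "s * real n / t < real (Suc i)"
          by linarith+
      qed
      have "s * real n / t < real n"
        using s \<open>t > 0\<close> elim by (simp add: field_simps)
      with i have "i < n" by linarith
      have cell: "t * real i / real n \<le> s" "s < t * real (Suc i) / real n"
        using i \<open>t > 0\<close> elim by (simp_all add: field_simps)
      have "card (V \<inter> {t * real (Suc i) / real n..<t}) \<le> card (V \<inter> {s<..<t})"
        using cell \<open>finite V\<close> by (intro card_mono) auto
      with s cell \<open>i < n\<close> show "\<exists>i<n. U \<inter> {t * real i / real n..<t * real (Suc i) / real n} \<noteq> {} \<and>
          card (V \<inter> {t * real (Suc i) / real n..<t}) < k"
        by (intro exI[of _ i]) auto
    next
      assume "\<exists>i<n. U \<inter> {t * real i / real n..<t * real (Suc i) / real n} \<noteq> {} \<and>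
          card (V \<inter> {t * real (Suc i) / real n..<t}) < k"
      then obtain i s where i: "i < n" "card (V \<inter> {t * real (Suc i) / real n..<t}) < k"
        and s: "s \<in> U" "t * real i / real n \<le> s" "s < t * real (Suc i) / real n"
        by auto
      have "0 \<le> t * real i / real n"
        using \<open>t > 0\<close> by simp
      moreover have "t * real (Suc i) / real n \<le> t"
        using \<open>i < n\<close> \<open>t > 0\<close> by (simp add: field_simps del: of_nat_Suc)
      \<comment> \<open>A message of \<open>V\<close> after \<open>s\<close> is more than
        \<open>d\<close> away from \<open>s\<close>, hence beyond the end of the cell.\<close>
      moreover have "V \<inter> {s<..<t} \<subseteq> V \<inter> {t * real (Suc i) / real n..<t}"
        using apart[OF s(1)] s(2) width[of i] by force
      then have "card (V \<inter> {s<..<t}) \<le> card (V \<inter> {t * real (Suc i) / real n..<t})"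
        using \<open>finite V\<close> by (intro card_mono) auto
      ultimately show "visible U V k t"
        unfolding visible_def using s i by (intro bexI[of _ s]) auto
    qed
  qed
qed

subsection \<open>The random feed\<close>

text \<open>\<open>Q\<close> is the pointwise limit of the \<open>P n\<close>: measurable as a
  countable limit inferior, with convergence of probabilities by dominated convergence of
  indicators.\<close>

lemma (in prob_space) eventually_iff_limit:
  assumes P[measurable]: "\<And>n :: nat. {\<omega> \<in> space M. P n \<omega>} \<in> events" and A[measurable]: "A \<in> events"
    and ev: "\<And>\<omega>. \<omega> \<in> space M \<Longrightarrow> \<forall>\<^sub>F n in sequentially. Q \<omega> \<longleftrightarrow> P n \<omega>"
  shows events_eventually_iff: "{\<omega> \<in> space M. Q \<omega>} \<in> events"
    and tendsto_prob_eventually_iff: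
      "(\<lambda>n. prob ({\<omega> \<in> space M. P n \<omega>} \<inter> A)) \<longlonglongrightarrow> prob ({\<omega> \<in> space M. Q \<omega>} \<inter> A)"
proof -
  have "Q \<omega> \<longleftrightarrow> (\<exists>N. \<forall>n\<ge>N. P n \<omega>)" if "\<omega> \<in> space M" for \<omega>
    using ev[OF that] unfolding eventually_sequentially by (meson nle_le)
  then have "{\<omega> \<in> space M. Q \<omega>} = {\<omega> \<in> space M. \<exists>N. \<forall>n\<ge>N. P n \<omega>}"
    by auto
  also have "\<dots> \<in> events"
    by measurable
  finally show Q[measurable]: "{\<omega> \<in> space M. Q \<omega>} \<in> events" .
  have "(\<lambda>n. \<integral>\<omega>. indicator ({\<omega> \<in> space M. P n \<omega>} \<inter> A) \<omega> \<partial>M) \<longlonglongrightarrow>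
      (\<integral>\<omega>. indicat_real ({\<omega> \<in> space M. Q \<omega>} \<inter> A) \<omega> \<partial>M)"
  proof (rule integral_dominated_convergence[where w="\<lambda>_. 1"])
    show "AE \<omega> in M. (\<lambda>n. indicator ({\<omega> \<in> space M. P n \<omega>} \<inter> A) \<omega>) \<longlonglongrightarrow>
        indicat_real ({\<omega> \<in> space M. Q \<omega>} \<inter> A) \<omega>"
    proof (rule AE_I2)
      fix \<omega> assume "\<omega> \<in> space M"
      from ev[OF this] have "\<forall>\<^sub>F n in sequentially. indicator ({\<omega> \<in> space M. P n \<omega>} \<inter> A) \<omega> =
          indicat_real ({\<omega> \<in> space M. Q \<omega>} \<inter> A) \<omega>"
        by eventually_elim (simp add: indicator_def)
      then show "(\<lambda>n. indicator ({\<omega> \<in> space M. P n \<omega>} \<inter> A) \<omega>) \<longlonglongrightarrow>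
          indicat_real ({\<omega> \<in> space M. Q \<omega>} \<inter> A) \<omega>"
        by (rule tendsto_eventually)
    qed
  qed (auto simp: indicator_def)
  then show "(\<lambda>n. prob ({\<omega> \<in> space M. P n \<omega>} \<inter> A)) \<longlonglongrightarrow> prob ({\<omega> \<in> space M. Q \<omega>} \<inter> A)"
    by (simp add: Int_absorb2)
qed

text \<open>A finite product of copies of the naturals is countable with measurable singletons, so
  every set of count vectors is measurable.\<close>

lemma sets_PiM_count_space_nat:
  assumes "finite I" "X \<subseteq> PiE I (\<lambda>_. UNIV)"
  shows "X \<in> sets (PiM I (\<lambda>_. count_space (UNIV :: nat set)))"
proof (rule sets.countable)
  show "countable X"
    using countable_subset[OF assms(2) countable_PiE[OF assms(1)]] by simp
next
  fix f assume "f \<in> X"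
  then have "f \<in> extensional I"
    using assms by (auto simp: PiE_def)
  then have "{f} = PiE I (\<lambda>i. {f i})"
    by (simp add: PiE_singleton)
  also have "\<dots> \<in> sets (PiM I (\<lambda>_. count_space UNIV))"
    using \<open>finite I\<close> by (intro sets_PiM_I_finite) auto
  finally show "{f} \<in> sets (PiM I (\<lambda>_. count_space UNIV))" .
qed

section \<open>Short windows of a single Poisson process\<close>

context inhomogeneous_poisson_process
begin

declare random_variable_events_in [measurable]

lemma events_in_eq_0_iff: "\<omega> \<in> space M \<Longrightarrow> events_in E (a, b) \<omega> = 0 \<longleftrightarrow> E \<omega> \<inter> {a..<b} = {}"
  using finite_events by (simp add: events_in_def)

lemma several_events_at_right:
  assumes "0 \<le> t" "t < T"
  shows "((\<lambda>s. \<P>(\<omega> in M. events_in E (t, s) \<omega> \<ge> 2) / (s - t)) \<longlongrightarrow> 0) (at_right t)"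
  using smalloD_tendsto[OF several_events[OF assms]]
  by (simp add: filterlim_at_right_to_0[of _ _ t] add.commute)

text \<open>Having at least one event means having exactly one or several, and the probability of
  several is negligible against the window length.\<close>

lemma some_event_at_right:
  assumes "0 \<le> t" "t < T"
  shows "((\<lambda>s. \<P>(\<omega> in M. events_in E (t, s) \<omega> \<ge> 1) / (s - t)) \<longlongrightarrow> rate t) (at_right t)"
proof -
  have "((\<lambda>h. (\<P>(\<omega> in M. events_in E (t, t + h) \<omega> = 1) - rate t * h) / h) \<longlongrightarrow> 0) (at_right 0)"
    using smalloD_tendsto[OF one_event[OF assms]] .
  then have "((\<lambda>h. (\<P>(\<omega> in M. events_in E (t, t + h) \<omega> = 1) - rate t * h) / h + rate t +
      \<P>(\<omega> in M. events_in E (t, t + h) \<omega> \<ge> 2) / h) \<longlongrightarrow> 0 + rate t + 0) (at_right 0)"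
    by (intro tendsto_add tendsto_const smalloD_tendsto[OF several_events[OF assms]])
  moreover have "\<forall>\<^sub>F h in at_right 0. (\<P>(\<omega> in M. events_in E (t, t + h) \<omega> = 1) - rate t * h) / h + rate t +
      \<P>(\<omega> in M. events_in E (t, t + h) \<omega> \<ge> 2) / h = \<P>(\<omega> in M. events_in E (t, t + h) \<omega> \<ge> 1) / h"
    using eventually_at_right_less[of 0]
  proof eventually_elim
    case (elim h)
    have "{\<omega> \<in> space M. events_in E (t, t + h) \<omega> \<ge> 1} =
        {\<omega> \<in> space M. events_in E (t, t + h) \<omega> = 1} \<union> {\<omega> \<in> space M. events_in E (t, t + h) \<omega> \<ge> 2}"
      by auto
    then have "\<P>(\<omega> in M. events_in E (t, t + h) \<omega> \<ge> 1) =
        \<P>(\<omega> in M. events_in E (t, t + h) \<omega> = 1) + \<P>(\<omega> in M. events_in E (t, t + h) \<omega> \<ge> 2)"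
      by (simp only:) (rule finite_measure_Union; auto)
    with elim show ?case
      by (simp add: field_simps)
  qed
  ultimately have "((\<lambda>h. \<P>(\<omega> in M. events_in E (t, t + h) \<omega> \<ge> 1) / h) \<longlongrightarrow> rate t) (at_right 0)"
    by (simp add: tendsto_cong)
  then show ?thesis
    by (simp add: filterlim_at_right_to_0[of _ _ t] add.commute)
qed

text \<open>Finitely many events leave a gap just before \<open>t\<close>, so on each outcome the
  window is eventually empty. The left continuity of the visibility probability comes from
  here.\<close>

lemma some_event_at_left: "((\<lambda>s. \<P>(\<omega> in M. events_in E (s, t) \<omega> \<ge> 1)) \<longlongrightarrow> 0) (at_left t)"
proof (rule tendsto_at_left_sequentially[of "t - 1"])
  fix S :: "nat \<Rightarrow> real" assume S: "S \<longlonglongrightarrow> t"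
  have "(\<lambda>n. prob ({\<omega> \<in> space M. events_in E (S n, t) \<omega> \<ge> 1} \<inter> space M)) \<longlonglongrightarrow>
      prob ({\<omega> \<in> space M. False} \<inter> space M)"
  proof (rule tendsto_prob_eventually_iff)
    fix \<omega> assume \<omega>: "\<omega> \<in> space M"
    have "\<forall>\<^sub>F n in sequentially. \<forall>e\<in>E \<omega> \<inter> {..<t}. e < S n"
      using finite_events[OF \<omega>] order_tendstoD(1)[OF S]
      by (intro eventually_ball_finite) auto
    then show "\<forall>\<^sub>F n in sequentially. False \<longleftrightarrow> events_in E (S n, t) \<omega> \<ge> 1"
    proof eventually_elim
      case (elim n)
      then have "E \<omega> \<inter> {S n..<t} = {}"
        by (meson IntI atLeastLessThan_iff disjoint_iff lessThan_iff not_less)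
      then have "events_in E (S n, t) \<omega> = 0"
        by (simp add: events_in_eq_0_iff[OF \<omega>])
      then show ?case by simp
    qed
  qed auto
  then show "(\<lambda>n. \<P>(\<omega> in M. events_in E (S n, t) \<omega> \<ge> 1)) \<longlonglongrightarrow> 0"
    by (simp add: Int_absorb2)
qed simp

end

section \<open>Independence of windows across both processes\<close>

context follower_feed
begin

sublocale src: inhomogeneous_poisson_process M T rateU U
  by (rule broadcaster)

sublocale oth: inhomogeneous_poisson_process M T rateV V
  by (rule others)

lemma prob_events_in_mult:
  "\<P>(\<omega> in M. events_in U I \<omega> \<in> A \<and> events_in V J \<omega> \<in> B) =
     \<P>(\<omega> in M. events_in U I \<omega> \<in> A) * \<P>(\<omega> in M. events_in V J \<omega> \<in> B)"
proof -
  have "prob ((\<lambda>\<omega>. (\<lambda>I. events_in U I \<omega>, \<lambda>I. events_in V I \<omega>)) -`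
        ({f. f I \<in> A} \<times> {f. f J \<in> B}) \<inter> space M) =
      prob ((\<lambda>\<omega> I. events_in U I \<omega>) -` {f. f I \<in> A} \<inter> space M) *
      prob ((\<lambda>\<omega> I. events_in V I \<omega>) -` {f. f J \<in> B} \<inter> space M)"
  proof (rule indep_varD[OF independent])
    have *: "{f. f I \<in> A} \<in> sets (\<Pi>\<^sub>M I\<in>UNIV. count_space UNIV)" for I :: "real \<times> real" and A :: "nat set"
      using measurable_sets[OF measurable_component_singleton[of I UNIV "\<lambda>_. count_space (UNIV :: nat set)"], of A]
      by (simp add: vimage_def space_PiM)
    show "{f. f I \<in> A} \<in> sets (\<Pi>\<^sub>M I\<in>UNIV. count_space UNIV)"
      and "{f. f J \<in> B} \<in> sets (\<Pi>\<^sub>M I\<in>UNIV. count_space UNIV)"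
      by (rule *)+
  qed
  then show ?thesis
    by (simp add: vimage_def Int_def conj_commute)
qed

text \<open>A common index set makes the counts of both senders one family, which can then be split
  into past cells and a fresh window.\<close>

definition sender_events :: "sender \<times> real \<times> real \<Rightarrow> 'a \<Rightarrow> nat" where
  "sender_events = (\<lambda>(c, I). events_in (case c of Broadcaster \<Rightarrow> U | Other \<Rightarrow> V) I)"

text \<open>Independence of the processes separates the two senders, and independent increments
  separate the windows of each. Since the index set is finite, the product formula over all indices
  is enough.\<close>

lemma indep_vars_sender_events:
  assumes J: "finite J" "J \<noteq> {}" "J \<subseteq> {(a, b). 0 \<le> a \<and> a < b \<and> b \<le> T}"
    "disjoint_family_on (\<lambda>(a, b). {a..<b}) J"
  shows "indep_vars (\<lambda>_. count_space UNIV) sender_events (UNIV \<times> J)"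
proof (subst indep_vars_finite[where E="\<lambda>_. UNIV"])
  show "UNIV \<times> J \<noteq> ({} :: (sender \<times> real \<times> real) set)" "finite ((UNIV :: sender set) \<times> J)"
    using J by (auto simp: UNIV_sender)
  show "random_variable (count_space UNIV) (sender_events i)" for i
    by (cases i; cases "fst i") (auto simp: sender_events_def)
  show "\<forall>A\<in>UNIV \<times> J \<rightarrow> UNIV. prob (\<Inter>j\<in>UNIV \<times> J. sender_events j -` A j \<inter> space M) =
      (\<Prod>j\<in>UNIV \<times> J. prob (sender_events j -` A j \<inter> space M))"
  proof
    fix A :: "sender \<times> real \<times> real \<Rightarrow> nat set"
    define X where "X c = (\<lambda>\<omega> I. events_in (case c of Broadcaster \<Rightarrow> U | Other \<Rightarrow> V) I \<omega>)" for c
    define S where "S c = {f \<in> space (\<Pi>\<^sub>M I\<in>UNIV. count_space UNIV). \<forall>I\<in>J. f I \<in> A (c, I)}" for c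
    have S: "S c \<in> sets (\<Pi>\<^sub>M I\<in>UNIV. count_space UNIV)" for c
      unfolding S_def using \<open>finite J\<close> by measurable
    have "(\<Inter>j\<in>UNIV \<times> J. sender_events j -` A j \<inter> space M) =
        (\<lambda>\<omega>. (X Broadcaster \<omega>, X Other \<omega>)) -` (S Broadcaster \<times> S Other) \<inter> space M"
      using J(2) by (auto simp: UNIV_sender sender_events_def X_def S_def space_PiM)
    also have "prob \<dots> = prob (X Broadcaster -` S Broadcaster \<inter> space M) * prob (X Other -` S Other \<inter> space M)"
      using S independent unfolding X_def by (intro indep_varD) auto
    also have "\<dots> = (\<Prod>c\<in>UNIV. prob (X c -` S c \<inter> space M))"
      by (simp add: UNIV_sender)
    also have "\<dots> = (\<Prod>c\<in>UNIV. \<Prod>I\<in>J. prob (sender_events (c, I) -` A (c, I) \<inter> space M))"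
    proof (rule prod.cong)
      fix c :: sender
      have "X c -` S c \<inter> space M = (\<Inter>I\<in>J. sender_events (c, I) -` A (c, I) \<inter> space M)"
        using J(2) by (auto simp: X_def S_def sender_events_def space_PiM)
      also have "prob \<dots> = (\<Prod>I\<in>J. prob (sender_events (c, I) -` A (c, I) \<inter> space M))"
      proof -
        have "indep_vars (\<lambda>_. count_space UNIV) (\<lambda>I. sender_events (c, I)) J"
          using src.independent_increments[OF J(3,4)] oth.independent_increments[OF J(3,4)]
          by (cases c) (simp_all add: sender_events_def)
        from indep_varsD[OF this J(2,1) subset_refl] show ?thesis
          by simp
      qed
      finally show "prob (X c -` S c \<inter> space M) = \<dots>" .
    qed simp
    also have "\<dots> = (\<Prod>j\<in>UNIV \<times> J. prob (sender_events j -` A j \<inter> space M))"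
      by (simp add: prod.cartesian_product case_prod_beta')
    finally show "prob (\<Inter>j\<in>UNIV \<times> J. sender_events j -` A j \<inter> space M) = \<dots>" .
  qed
qed (auto simp: Int_stable_def)

text \<open>
  A fine partition of \<open>[0, t)\<close> into cells turns visibility into a condition on finitely many counts.
  This gives measurability, and it transfers independence of disjoint windows to the whole past.
\<close>
lemma eventually_visible_iff_events_in:
  assumes "\<omega> \<in> space M" "t > 0"
  shows "\<forall>\<^sub>F n in sequentially. visible (U \<omega>) (V \<omega>) k t \<longleftrightarrow>
    (\<exists>i<n. events_in U (t * real i / real n, t * real (Suc i) / real n) \<omega> > 0 \<and>
       events_in V (t * real (Suc i) / real n, t) \<omega> < k)"
proof -
  have "finite (U \<omega>)" "finite (V \<omega>)"
    using assms src.finite_events oth.finite_events by auto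
  then show ?thesis
    using eventually_visible_iff_cells[of "U \<omega>" "V \<omega>" t k] \<open>t > 0\<close>
    by (simp add: events_in_def card_gt_0_iff)
qed

lemma measurable_visible[measurable]: "{\<omega> \<in> space M. visible (U \<omega>) (V \<omega>) k t} \<in> events"
proof (cases "t > 0")
  case True
  show ?thesis
    by (rule events_eventually_iff[OF _ sets.top eventually_visible_iff_events_in[OF _ True]]) measurable
qed (simp add: visible_nonpos)

lemma prob_visible_events_in_mult:
  assumes "0 \<le> t" "t < s" "s \<le> T"
  shows "\<P>(\<omega> in M. visible (U \<omega>) (V \<omega>) k t \<and> events_in U (t, s) \<omega> \<in> A \<and> events_in V (t, s) \<omega> \<in> B) =
    \<P>(\<omega> in M. visible (U \<omega>) (V \<omega>) k t) * \<P>(\<omega> in M. events_in U (t, s) \<omega> \<in> A \<and> events_in V (t, s) \<omega> \<in> B)"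
proof (cases "t = 0")
  case False
  with \<open>0 \<le> t\<close> have "t > 0" by simp
  \<comment> \<open>\<open>P n\<close> is visibility rounded to \<open>n\<close> equal cells. The
    product rule holds exactly for \<open>P n\<close> with \<open>n > 0\<close>, and both sides
    converge to those for \<open>visible\<close>.\<close>
  define P where "P n \<omega> \<longleftrightarrow>
    (\<exists>i<n. events_in U (t * real i / real n, t * real (Suc i) / real n) \<omega> > 0 \<and>
       events_in V (t * real (Suc i) / real n, t) \<omega> < k)" for n \<omega>
  define C where "C = {\<omega> \<in> space M. events_in U (t, s) \<omega> \<in> A \<and> events_in V (t, s) \<omega> \<in> B}"
  have [measurable]: "{\<omega> \<in> space M. P n \<omega>} \<in> events" for n
    unfolding P_def by measurable
  have [measurable]: "C \<in> events"
    unfolding C_def by measurable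
  have lim: "(\<lambda>n. prob ({\<omega> \<in> space M. P n \<omega>} \<inter> D)) \<longlonglongrightarrow>
      prob ({\<omega> \<in> space M. visible (U \<omega>) (V \<omega>) k t} \<inter> D)" if "D \<in> events" for D
  proof (rule tendsto_prob_eventually_iff[OF _ that])
    show "\<forall>\<^sub>F n in sequentially. visible (U \<omega>) (V \<omega>) k t \<longleftrightarrow> P n \<omega>" if "\<omega> \<in> space M" for \<omega>
      unfolding P_def by (rule eventually_visible_iff_events_in[OF that \<open>t > 0\<close>])
  qed measurable
  have "(\<lambda>n. prob ({\<omega> \<in> space M. P n \<omega>} \<inter> C)) \<longlonglongrightarrow> prob ({\<omega> \<in> space M. visible (U \<omega>) (V \<omega>) k t} \<inter> C)"
    by (rule lim) auto
  moreover have "(\<lambda>n. prob ({\<omega> \<in> space M. P n \<omega>} \<inter> C)) \<longlonglongrightarrow>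
      prob ({\<omega> \<in> space M. visible (U \<omega>) (V \<omega>) k t} \<inter> space M) * prob C"
  proof (rule Lim_transform_eventually)
    show "(\<lambda>n. prob ({\<omega> \<in> space M. P n \<omega>} \<inter> space M) * prob C) \<longlonglongrightarrow>
        prob ({\<omega> \<in> space M. visible (U \<omega>) (V \<omega>) k t} \<inter> space M) * prob C"
      by (intro tendsto_mult tendsto_const lim) auto
    show "\<forall>\<^sub>F n in sequentially.
        prob ({\<omega> \<in> space M. P n \<omega>} \<inter> space M) * prob C = prob ({\<omega> \<in> space M. P n \<omega>} \<inter> C)"
      using eventually_gt_at_top[of 0]
    proof eventually_elim
      case (elim n)
      define c where "c i = t * real i / real n" for i
      have "mono c"
        using \<open>t > 0\<close> by (auto simp: c_def mono_def intro!: divide_right_mono mult_left_mono)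
      have c_less: "c i < c (Suc i)" for i
        using \<open>t > 0\<close> elim by (simp add: c_def field_simps)
      have c_n: "c n = t" and c_0: "c 0 = 0"
        using elim by (simp_all add: c_def)
      have c_bounds: "0 \<le> c i" "c (Suc i) \<le> t" if "i < n" for i
        using monoD[OF \<open>mono c\<close>, of 0 i] monoD[OF \<open>mono c\<close>, of "Suc i" n] that c_n c_0 by auto
      define I where "I = (\<lambda>i. (c i, c (Suc i))) ` {..<n}"
      have cells_disjoint: "{c i..<c (Suc i)} \<inter> {c j..<c (Suc j)} = {}" if "i < j" for i j
        using monoD[OF \<open>mono c\<close>, of "Suc i" j] that by force
      have "disjoint_family_on (\<lambda>(a, b). {a..<b}) I"
        unfolding disjoint_family_on_def
      proof (intro ballI impI)
        fix x y assume "x \<in> I" "y \<in> I" "x \<noteq> y"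
        then obtain i j where ij: "x = (c i, c (Suc i))" "y = (c j, c (Suc j))" "i \<noteq> j"
          by (auto simp: I_def)
        then show "(case x of (a, b) \<Rightarrow> {a..<b}) \<inter> (case y of (a, b) \<Rightarrow> {a..<b}) = {}"
          using cells_disjoint[of i j] cells_disjoint[of j i]
          by (cases i j rule: linorder_cases) auto
      qed
      moreover have before: "{a..<b} \<inter> {t..<s} = {}" if "(a, b) \<in> I" for a b
        using that c_bounds by (force simp: I_def)
      ultimately have disjoint: "disjoint_family_on (\<lambda>(a, b). {a..<b}) (insert (t, s) I)"
        unfolding disjoint_family_on_def by fast
      have fresh: "(t, s) \<notin> I"
        using before[of t s] \<open>t < s\<close> by auto
      have "indep_vars (\<lambda>_. count_space UNIV) sender_events (UNIV \<times> insert (t, s) I)"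
        using c_bounds c_less assms disjoint
        by (intro indep_vars_sender_events) (force simp: I_def)+
      \<comment> \<open>Past cells and the window \<open>(t, s)\<close> are disjoint blocks of one
        independent family, so their count vectors are independent.\<close>
      then have indep: "indep_var
          (PiM (UNIV \<times> I) (\<lambda>_. count_space UNIV)) (\<lambda>\<omega>. restrict (\<lambda>i. sender_events i \<omega>) (UNIV \<times> I))
          (PiM (UNIV \<times> {(t, s)}) (\<lambda>_. count_space UNIV)) (\<lambda>\<omega>. restrict (\<lambda>i. sender_events i \<omega>) (UNIV \<times> {(t, s)}))"
        by (rule indep_var_restrict) (use fresh in auto)
      \<comment> \<open>\<open>X\<close> expresses \<open>P n\<close> through cell counts: the cells
        \<open>Suc i\<close> to \<open>n - 1\<close> tile the window from \<open>c (Suc i)\<close>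
        to \<open>t\<close>.\<close>
      define X where "X = {f \<in> PiE (UNIV \<times> I) (\<lambda>_. UNIV :: nat set). \<exists>i<n. f (Broadcaster, c i, c (Suc i)) > 0 \<and>
          (\<Sum>j\<in>{Suc i..<n}. f (Other, c j, c (Suc j))) < k}"
      define Y where "Y = {f \<in> PiE (UNIV \<times> {(t, s)}) (\<lambda>_. UNIV :: nat set). f (Broadcaster, t, s) \<in> A \<and> f (Other, t, s) \<in> B}"
      have fin: "finite ((UNIV :: sender set) \<times> I)" "finite ((UNIV :: sender set) \<times> {(t, s)})"
        by (auto simp: UNIV_sender I_def)
      have "X \<in> sets (PiM (UNIV \<times> I) (\<lambda>_. count_space UNIV))"
        using fin by (intro sets_PiM_count_space_nat) (auto simp: X_def)
      moreover have "Y \<in> sets (PiM (UNIV \<times> {(t, s)}) (\<lambda>_. count_space UNIV))"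
        using fin by (intro sets_PiM_count_space_nat) (auto simp: Y_def)
      moreover have X: "restrict (\<lambda>i. sender_events i \<omega>) (UNIV \<times> I) \<in> X \<longleftrightarrow> P n \<omega>" if "\<omega> \<in> space M" for \<omega>
      proof -
        have "(\<Sum>j\<in>{Suc i..<n}. sender_events (Other, c j, c (Suc j)) \<omega>) = events_in V (c (Suc i), t) \<omega>"
          if "i < n" for i
          using sum_card_Int_Ico[of "V \<omega>" c "Suc i" n] oth.finite_events[OF \<open>\<omega> \<in> space M\<close>] \<open>mono c\<close> that c_n
          by (simp add: sender_events_def events_in_def)
        moreover have "(\<Sum>j\<in>{Suc i..<n}. restrict (\<lambda>i. sender_events i \<omega>) (UNIV \<times> I) (Other, c j, c (Suc j))) =
            (\<Sum>j\<in>{Suc i..<n}. sender_events (Other, c j, c (Suc j)) \<omega>)" for i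
          by (intro sum.cong) (auto simp: I_def)
        moreover have "restrict (\<lambda>i. sender_events i \<omega>) (UNIV \<times> I) (Broadcaster, c i, c (Suc i)) =
            events_in U (c i, c (Suc i)) \<omega>" if "i < n" for i
          using that by (auto simp: I_def sender_events_def)
        ultimately show ?thesis
          unfolding X_def P_def c_def[symmetric] by (auto simp del: restrict_apply)
      qed
      moreover have Y: "restrict (\<lambda>i. sender_events i \<omega>) (UNIV \<times> {(t, s)}) \<in> Y \<longleftrightarrow> \<omega> \<in> C" if "\<omega> \<in> space M" for \<omega>
        using that by (auto simp: Y_def C_def sender_events_def)
      have "(\<lambda>\<omega>. (restrict (\<lambda>i. sender_events i \<omega>) (UNIV \<times> I), restrict (\<lambda>i. sender_events i \<omega>) (UNIV \<times> {(t, s)}))) -`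
          (X \<times> Y) \<inter> space M = {\<omega> \<in> space M. P n \<omega>} \<inter> C"
        using X Y by auto
      moreover have "(\<lambda>\<omega>. restrict (\<lambda>i. sender_events i \<omega>) (UNIV \<times> I)) -` X \<inter> space M = {\<omega> \<in> space M. P n \<omega>}"
        using X by auto
      moreover have "(\<lambda>\<omega>. restrict (\<lambda>i. sender_events i \<omega>) (UNIV \<times> {(t, s)})) -` Y \<inter> space M = C"
        using Y by (auto simp: C_def)
      ultimately show ?case
        using indep_varD[OF indep, of X Y] by (simp add: Int_absorb2)
    qed
  qed
  ultimately have "prob ({\<omega> \<in> space M. visible (U \<omega>) (V \<omega>) k t} \<inter> C) =
      prob ({\<omega> \<in> space M. visible (U \<omega>) (V \<omega>) k t} \<inter> space M) * prob C"
    by (rule LIMSEQ_unique)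
  moreover have "{\<omega> \<in> space M. visible (U \<omega>) (V \<omega>) k t} \<inter> C =
      {\<omega> \<in> space M. visible (U \<omega>) (V \<omega>) k t \<and> events_in U (t, s) \<omega> \<in> A \<and> events_in V (t, s) \<omega> \<in> B}"
    by (auto simp: C_def)
  ultimately show ?thesis
    by (simp add: C_def Int_absorb2)
qed (simp add: visible_nonpos)

section \<open>Evolution equation of the visibility probability\<close>

abbreviation prob_visible :: "nat \<Rightarrow> real \<Rightarrow> real" where
  "prob_visible k t \<equiv> \<P>(\<omega> in M. visible (U \<omega>) (V \<omega>) k t)"

lemma finite_events_U_V: "\<omega> \<in> space M \<Longrightarrow> finite (U \<omega>)" "\<omega> \<in> space M \<Longrightarrow> finite (V \<omega>)"
  using src.finite_events oth.finite_events by auto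

lemma visible_iff_before:
  assumes "\<omega> \<in> space M" "0 \<le> t" "t \<le> s" "events_in U (t, s) \<omega> = 0"
  shows "visible (U \<omega>) (V \<omega>) k s \<longleftrightarrow> visible (U \<omega>) (V \<omega>) (k - events_in V (t, s) \<omega>) t"
  using assms visible_step_none[of "U \<omega>" "V \<omega>" t s k] finite_events_U_V
  by (simp add: src.events_in_eq_0_iff) (simp add: events_in_def)

lemma visible_if_broadcast:
  assumes "\<omega> \<in> space M" "0 \<le> t" "t \<le> s" "events_in U (t, s) \<omega> \<noteq> 0" "events_in V (t, s) \<omega> = 0" "k \<ge> 1"
  shows "visible (U \<omega>) (V \<omega>) k s"
  using assms visible_step_broadcaster[of "U \<omega>" "V \<omega>" t s k] finite_events_U_V
  by (simp add: src.events_in_eq_0_iff oth.events_in_eq_0_iff)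

text \<open>An empty window leaves visibility unchanged, so the events at \<open>t\<close> and
  \<open>s\<close> differ only where a message arrives; the rest is a union bound.\<close>

lemma prob_visible_increment:
  assumes "0 \<le> t" "t \<le> s"
  shows "\<bar>prob_visible k s - prob_visible k t\<bar> \<le> \<P>(\<omega> in M. events_in U (t, s) \<omega> \<ge> 1) + \<P>(\<omega> in M. events_in V (t, s) \<omega> \<ge> 1)"
proof -
  have le: "prob A \<le> prob B + (\<P>(\<omega> in M. events_in U (t, s) \<omega> \<ge> 1) + \<P>(\<omega> in M. events_in V (t, s) \<omega> \<ge> 1))"
    if [measurable]: "A \<in> events" "B \<in> events"
      and sub: "A \<subseteq> B \<union> ({\<omega> \<in> space M. events_in U (t, s) \<omega> \<ge> 1} \<union> {\<omega> \<in> space M. events_in V (t, s) \<omega> \<ge> 1})"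
    for A B
  proof -
    have "prob A \<le> prob (B \<union> ({\<omega> \<in> space M. events_in U (t, s) \<omega> \<ge> 1} \<union> {\<omega> \<in> space M. events_in V (t, s) \<omega> \<ge> 1}))"
      by (rule finite_measure_mono[OF sub]) measurable
    also have "\<dots> \<le> prob B + prob ({\<omega> \<in> space M. events_in U (t, s) \<omega> \<ge> 1} \<union> {\<omega> \<in> space M. events_in V (t, s) \<omega> \<ge> 1})"
      by (intro measure_Un_le) measurable
    also have "\<dots> \<le> prob B + (\<P>(\<omega> in M. events_in U (t, s) \<omega> \<ge> 1) + \<P>(\<omega> in M. events_in V (t, s) \<omega> \<ge> 1))"
      by (intro add_left_mono measure_Un_le) measurable
    finally show ?thesis .
  qed
  have same: "visible (U \<omega>) (V \<omega>) k s \<longleftrightarrow> visible (U \<omega>) (V \<omega>) k t"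
    if "\<omega> \<in> space M" "\<not> events_in U (t, s) \<omega> \<ge> 1" "\<not> events_in V (t, s) \<omega> \<ge> 1" for \<omega>
  proof -
    have "events_in U (t, s) \<omega> = 0" "events_in V (t, s) \<omega> = 0"
      using that by linarith+
    then show ?thesis
      using visible_iff_before[OF that(1) assms] by simp
  qed
  have "prob_visible k s \<le> prob_visible k t + (\<P>(\<omega> in M. events_in U (t, s) \<omega> \<ge> 1) + \<P>(\<omega> in M. events_in V (t, s) \<omega> \<ge> 1))"
    by (rule le) (measurable, use same in blast)
  moreover have "prob_visible k t \<le> prob_visible k s + (\<P>(\<omega> in M. events_in U (t, s) \<omega> \<ge> 1) + \<P>(\<omega> in M. events_in V (t, s) \<omega> \<ge> 1))"
    by (rule le) (measurable, use same in blast)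
  ultimately show ?thesis by linarith
qed

lemma prob_visible_at_left:
  assumes "0 < t"
  shows "(prob_visible k \<longlongrightarrow> prob_visible k t) (at_left t)"
proof -
  have "((\<lambda>s. prob_visible k t - prob_visible k s) \<longlongrightarrow> 0) (at_left t)"
  proof (rule Lim_null_comparison)
    show "\<forall>\<^sub>F s in at_left t. norm (prob_visible k t - prob_visible k s) \<le>
        \<P>(\<omega> in M. events_in U (s, t) \<omega> \<ge> 1) + \<P>(\<omega> in M. events_in V (s, t) \<omega> \<ge> 1)"
      using eventually_at_left_real[OF assms]
      by eventually_elim (simp only: real_norm_def, rule prob_visible_increment, auto)
    show "((\<lambda>s. \<P>(\<omega> in M. events_in U (s, t) \<omega> \<ge> 1) + \<P>(\<omega> in M. events_in V (s, t) \<omega> \<ge> 1)) \<longlongrightarrow> 0) (at_left t)"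
      using tendsto_add[OF src.some_event_at_left oth.some_event_at_left] by simp
  qed
  from tendsto_diff[OF tendsto_const[of "prob_visible k t"] this] show ?thesis by simp
qed

text \<open>
  The three main terms are the windows \<open>[t, s)\<close> without any message, with messages of the
  broadcaster only, and with exactly one message of another sender; \<open>c\<close> and \<open>a * b\<close>
  pay for all remaining windows.
\<close>
lemma prob_visible_step:
  fixes t s k
  assumes "0 \<le> t" "t < s" "s \<le> T"
  defines "a \<equiv> \<P>(\<omega> in M. events_in U (t, s) \<omega> \<ge> 1)"
    and "b \<equiv> \<P>(\<omega> in M. events_in V (t, s) \<omega> \<ge> 1)"
    and "c \<equiv> \<P>(\<omega> in M. events_in V (t, s) \<omega> \<ge> 2)"
  shows "\<bar>prob_visible (Suc k) s - (prob_visible (Suc k) t * ((1 - a) * (1 - b)) + a * (1 - b) + prob_visible k t * ((1 - a) * (b - c)))\<bar> \<le> a * b + c"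
proof -
  let ?u = "events_in U (t, s)" and ?v = "events_in V (t, s)"
  let ?N = "\<lambda>A B. {\<omega> \<in> space M. ?u \<omega> \<in> A \<and> ?v \<omega> \<in> B}"
  let ?S = "{\<omega> \<in> space M. visible (U \<omega>) (V \<omega>) (Suc k) s}"
  have none: "\<P>(\<omega> in M. events_in X I \<omega> \<in> {0}) = 1 - \<P>(\<omega> in M. events_in X I \<omega> \<ge> 1)"
    if [measurable]: "random_variable (count_space UNIV) (events_in X I)" for X I
  proof -
    have "{\<omega> \<in> space M. events_in X I \<omega> \<in> {0}} = space M - {\<omega> \<in> space M. events_in X I \<omega> \<ge> 1}"
      by auto
    then show ?thesis
      by (simp add: prob_compl)
  qed
  have u0: "\<P>(\<omega> in M. ?u \<omega> \<in> {0}) = 1 - a" and v0: "\<P>(\<omega> in M. ?v \<omega> \<in> {0}) = 1 - b"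
    unfolding a_def b_def by (rule none, measurable)+
  have v1: "\<P>(\<omega> in M. ?v \<omega> \<in> {1}) = b - c"
  proof -
    have "{\<omega> \<in> space M. ?v \<omega> \<ge> 1} = {\<omega> \<in> space M. ?v \<omega> \<in> {1}} \<union> {\<omega> \<in> space M. ?v \<omega> \<ge> 2}"
      by auto
    then have "b = \<P>(\<omega> in M. ?v \<omega> \<in> {1}) + c"
      unfolding b_def c_def by (simp only:) (rule finite_measure_Union; auto)
    then show ?thesis by simp
  qed
  have N: "prob (?N A B) = \<P>(\<omega> in M. ?u \<omega> \<in> A) * \<P>(\<omega> in M. ?v \<omega> \<in> B)" for A B
    by (rule prob_events_in_mult)
  have vis: "prob ({\<omega> \<in> space M. visible (U \<omega>) (V \<omega>) j t} \<inter> ?N A B) = prob_visible j t * prob (?N A B)" for j A B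
    using prob_visible_events_in_mult[OF assms(1-3), of j A B]
    by (simp add: Int_def conj_ac)
  define S1 where "S1 = {\<omega> \<in> space M. visible (U \<omega>) (V \<omega>) (Suc k) t} \<inter> ?N {0} {0}"
  define S2 where "S2 = ?N {1..} {0}"
  \<comment> \<open>The single other message lowers the budget from \<open>Suc k\<close> to
    \<open>k\<close>; this couples the equation for \<open>Suc k\<close> to the one for
    \<open>k\<close>.\<close>
  define S3 where "S3 = {\<omega> \<in> space M. visible (U \<omega>) (V \<omega>) k t} \<inter> ?N {0} {1}"
  \<comment> \<open>The remainder: messages of both kinds, or at least two others and no broadcaster
    message. Only an upper bound on its probability is used.\<close>
  define S4 where "S4 = ?S \<inter> (?N {1..} {1..} \<union> ?N {0} {2..})"
  have N_events: "?N A B \<in> events" for A B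
    by measurable
  have [measurable]: "S1 \<in> events" "S2 \<in> events" "S3 \<in> events" "S4 \<in> events"
    unfolding S1_def S2_def S3_def S4_def by (intro sets.Int sets.Un measurable_visible N_events)+
  have "?S = S1 \<union> (S2 \<union> (S3 \<union> S4))"
  proof (rule set_eqI)
    fix \<omega>
    show "\<omega> \<in> ?S \<longleftrightarrow> \<omega> \<in> S1 \<union> (S2 \<union> (S3 \<union> S4))"
    proof (cases "\<omega> \<in> space M")
      case True
      have iff: "visible (U \<omega>) (V \<omega>) (Suc k) s \<longleftrightarrow> visible (U \<omega>) (V \<omega>) (Suc k - ?v \<omega>) t" if "?u \<omega> = 0"
        by (rule visible_iff_before) (use True assms that in auto)
      have br: "visible (U \<omega>) (V \<omega>) (Suc k) s" if "?u \<omega> \<noteq> 0" "?v \<omega> = 0"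
        by (rule visible_if_broadcast[of _ t]) (use True assms that in auto)
      consider "?v \<omega> = 0" | "?v \<omega> = 1" | "?v \<omega> \<ge> 2" by linarith
      then show ?thesis
        by cases (cases "?u \<omega> = 0"; use True iff br in \<open>auto simp: S1_def S2_def S3_def S4_def\<close>)+
    qed (auto simp: S1_def S2_def S3_def S4_def)
  qed
  then have "prob_visible (Suc k) s = prob (S1 \<union> (S2 \<union> (S3 \<union> S4)))"
    by simp
  also have "\<dots> = prob S1 + prob (S2 \<union> (S3 \<union> S4))"
    by (rule finite_measure_Union) (measurable, auto simp: S1_def S2_def S3_def S4_def)
  also have "prob (S2 \<union> (S3 \<union> S4)) = prob S2 + prob (S3 \<union> S4)"
    by (rule finite_measure_Union) (measurable, auto simp: S1_def S2_def S3_def S4_def)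
  also have "prob (S3 \<union> S4) = prob S3 + prob S4"
    by (rule finite_measure_Union) (measurable, auto simp: S1_def S2_def S3_def S4_def)
  also have "prob S1 = prob_visible (Suc k) t * ((1 - a) * (1 - b))"
    unfolding S1_def vis N u0 v0 by simp
  also have "prob S2 = a * (1 - b)"
    unfolding S2_def N v0 by (simp add: a_def)
  also have "prob S3 = prob_visible k t * ((1 - a) * (b - c))"
    unfolding S3_def vis N u0 v1 by simp
  finally have eq: "prob_visible (Suc k) s - (prob_visible (Suc k) t * ((1 - a) * (1 - b)) + a * (1 - b) + prob_visible k t * ((1 - a) * (b - c))) = prob S4"
    by simp
  have "prob S4 \<le> prob (?N {1..} {1..} \<union> ?N {0} {2..})"
    unfolding S4_def by (rule finite_measure_mono) auto
  also have "\<dots> \<le> prob (?N {1..} {1..}) + prob (?N {0} {2..})"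
    by (intro measure_Un_le N_events)
  also have "prob (?N {0} {2..}) \<le> c"
    unfolding c_def by (rule finite_measure_mono) auto
  also have "prob (?N {1..} {1..}) = a * b"
    unfolding N by (simp add: a_def b_def)
  finally show ?thesis
    unfolding eq by simp
qed

text \<open>The step estimate is divided by \<open>s - t\<close>: the one-message probabilities
  become the rates, while the errors \<open>a * b\<close> and \<open>c\<close> are of smaller order
  than \<open>s - t\<close>.\<close>

lemma has_real_derivative_prob_visible:
  assumes "0 \<le> t" "t < T"
  shows "(prob_visible (Suc k) has_real_derivative rateU t * (1 - prob_visible (Suc k) t) + rateV t * (prob_visible k t - prob_visible (Suc k) t)) (at_right t)"
proof -
  define a where "a s = \<P>(\<omega> in M. events_in U (t, s) \<omega> \<ge> 1)" for s
  define b where "b s = \<P>(\<omega> in M. events_in V (t, s) \<omega> \<ge> 1)" for s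
  define c where "c s = \<P>(\<omega> in M. events_in V (t, s) \<omega> \<ge> 2)" for s
  define A where "A s = a s / (s - t)" for s
  define B where "B s = b s / (s - t)" for s
  define C where "C s = c s / (s - t)" for s
  have A: "(A \<longlongrightarrow> rateU t) (at_right t)" and B: "(B \<longlongrightarrow> rateV t) (at_right t)" and C: "(C \<longlongrightarrow> 0) (at_right t)"
    unfolding A_def B_def C_def a_def b_def c_def
    by (rule src.some_event_at_right oth.some_event_at_right oth.several_events_at_right; fact assms)+
  have gap: "((\<lambda>s. s - t) \<longlongrightarrow> 0) (at_right t)"
    by (rule LIM_zero) (rule tendsto_ident_at)
  have a: "((\<lambda>s. A s * (s - t)) \<longlongrightarrow> 0) (at_right t)" and b: "((\<lambda>s. B s * (s - t)) \<longlongrightarrow> 0) (at_right t)"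
    using tendsto_mult[OF A gap] tendsto_mult[OF B gap] by simp_all
  \<comment> \<open>The main terms of \<open>prob_visible_step\<close> minus
    \<open>prob_visible (Suc k) t\<close>, divided by \<open>s - t\<close> after substituting
    \<open>a s = A s * (s - t)\<close> and likewise for \<open>b\<close> and
    \<open>c\<close>.\<close>
  define main where "main s = prob_visible (Suc k) t * (- A s - B s + A s * (B s * (s - t))) +
      A s * (1 - B s * (s - t)) + prob_visible k t * ((1 - A s * (s - t)) * (B s - C s))" for s
  have main: "(main \<longlongrightarrow> prob_visible (Suc k) t * (- rateU t - rateV t + rateU t * 0) + rateU t * (1 - 0) +
      prob_visible k t * ((1 - 0) * (rateV t - 0))) (at_right t)"
    unfolding main_def by (intro tendsto_intros A B C a b)
  have error: "((\<lambda>s. (prob_visible (Suc k) s - prob_visible (Suc k) t) / (s - t) - main s) \<longlongrightarrow> 0) (at_right t)"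
  proof (rule Lim_null_comparison)
    show "((\<lambda>s. A s * (B s * (s - t)) + C s) \<longlongrightarrow> 0) (at_right t)"
      using tendsto_add[OF tendsto_mult[OF A b] C] by simp
    show "\<forall>\<^sub>F s in at_right t. norm ((prob_visible (Suc k) s - prob_visible (Suc k) t) / (s - t) - main s) \<le> A s * (B s * (s - t)) + C s"
      using eventually_at_right_real[OF \<open>t < T\<close>]
    proof eventually_elim
      case (elim s)
      then have s: "t < s" "s \<le> T" "s - t \<noteq> 0" by auto
      have abc: "a s = A s * (s - t)" "b s = B s * (s - t)" "c s = C s * (s - t)"
        using s by (simp_all add: A_def B_def C_def)
      have "prob_visible (Suc k) s - (prob_visible (Suc k) t * ((1 - a s) * (1 - b s)) + a s * (1 - b s) + prob_visible k t * ((1 - a s) * (b s - c s))) =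
          (prob_visible (Suc k) s - prob_visible (Suc k) t) - main s * (s - t)"
        unfolding abc main_def by (simp add: algebra_simps)
      also have "\<dots> = ((prob_visible (Suc k) s - prob_visible (Suc k) t) / (s - t) - main s) * (s - t)"
        using s by (subst left_diff_distrib) simp
      also have "\<bar>\<dots>\<bar> = \<bar>(prob_visible (Suc k) s - prob_visible (Suc k) t) / (s - t) - main s\<bar> * (s - t)"
        using s by (simp add: abs_mult)
      finally have "\<bar>(prob_visible (Suc k) s - prob_visible (Suc k) t) / (s - t) - main s\<bar> * (s - t) \<le> a s * b s + c s"
        using prob_visible_step[OF assms(1) s(1,2), of k] by (simp add: a_def b_def c_def)
      also have "\<dots> = (A s * (B s * (s - t)) + C s) * (s - t)"
        unfolding abc by (simp add: algebra_simps)
      finally show ?case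
        using s by simp
    qed
  qed
  have "((\<lambda>s. (prob_visible (Suc k) s - prob_visible (Suc k) t) / (s - t)) \<longlongrightarrow>
      rateU t * (1 - prob_visible (Suc k) t) + rateV t * (prob_visible k t - prob_visible (Suc k) t)) (at_right t)"
    using tendsto_add[OF error main] by (simp add: algebra_simps)
  then show ?thesis
    by (simp add: has_field_derivative_iff)
qed

section \<open>Removing the initial feed and solving the equations\<close>

lemma visibility_eq_prob_visible:
  assumes "visibility M U V F k 0 = 0"
  shows "visibility M U V F k t = prob_visible k t"
proof -
  have rank_measurable: "{\<omega> \<in> space M. rank (F \<omega>) \<le> enat j} \<in> events" for j
  proof -
    have [measurable]: "F \<in> measurable M (stream_space (count_space UNIV))"
      by (rule initial_feed)
    have "rank (F \<omega>) \<le> enat j \<longleftrightarrow> (\<exists>i<j. F \<omega> !! i = Broadcaster)" for \<omega>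
      by (auto simp: rank_le_iff in_set_conv_nth stake_nth)
    then show ?thesis by simp
  qed
  have fin: "finite (U \<omega>)" "finite (V \<omega>)" if "\<omega> \<in> space M" for \<omega>
    using finite_events_U_V that by auto
  \<comment> \<open>At time 0 nothing has been received, so the boundary condition is a statement
    about the initial feed itself.\<close>
  have "prob {\<omega> \<in> space M. rank (F \<omega>) \<le> enat k} = 0"
  proof -
    have "{\<omega> \<in> space M. rank (feed (U \<omega>) (V \<omega>) (F \<omega>) 0) \<le> enat k} = {\<omega> \<in> space M. rank (F \<omega>) \<le> enat k}"
      using fin by (auto simp: rank_feed_le_iff visible_nonpos)
    with assms show ?thesis
      by (simp add: visibility_def)
  qed
  then have null: "AE \<omega> in M. \<not> rank (F \<omega>) \<le> enat k"
    using rank_measurable[of k] by (subst (asm) prob_eq_0) auto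
  define N where "N \<omega> = events_in U (0, t) \<omega> + events_in V (0, t) \<omega>" for \<omega>
  have [measurable]: "N \<in> measurable M (count_space UNIV)"
    unfolding N_def by measurable
  have iff: "rank (feed (U \<omega>) (V \<omega>) (F \<omega>) t) \<le> enat k \<longleftrightarrow>
      visible (U \<omega>) (V \<omega>) k t \<or> rank (F \<omega>) \<le> enat (k - N \<omega>)" if "\<omega> \<in> space M" for \<omega>
    using rank_feed_le_iff[OF fin[OF that]] by (simp add: N_def events_in_def)
  \<comment> \<open>Splitting over the countably many values of \<open>N\<close> gives
    measurability, however \<open>F\<close> depends on the arrivals.\<close>
  have "{\<omega> \<in> space M. rank (feed (U \<omega>) (V \<omega>) (F \<omega>) t) \<le> enat k} =
      {\<omega> \<in> space M. visible (U \<omega>) (V \<omega>) k t \<or> (\<exists>n. N \<omega> = n \<and> rank (F \<omega>) \<le> enat (k - n))}"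
    using iff by auto
  also have "\<dots> \<in> events"
    using rank_measurable by measurable
  finally have "{\<omega> \<in> space M. rank (feed (U \<omega>) (V \<omega>) (F \<omega>) t) \<le> enat k} \<in> events" .
  moreover have "AE \<omega> in M. \<omega> \<in> {\<omega> \<in> space M. rank (feed (U \<omega>) (V \<omega>) (F \<omega>) t) \<le> enat k} \<longleftrightarrow>
      \<omega> \<in> {\<omega> \<in> space M. visible (U \<omega>) (V \<omega>) k t}"
    using null
  proof eventually_elim
    case (elim \<omega>)
    have "\<not> rank (F \<omega>) \<le> enat (k - N \<omega>)"
      using elim order_trans[of "rank (F \<omega>)" "enat (k - N \<omega>)" "enat k"] by auto
    then show ?case
      using iff by auto
  qed
  ultimately show ?thesis
    unfolding visibility_def by (intro finite_measure_eq_AE) auto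
qed

text \<open>The integrating factor turns the evolution equation into one whose right-hand side
  contains only index \<open>k\<close>, and the sums on the right satisfy it as well. By induction
  the difference has zero right derivative; it is left continuous and vanishes at 0.\<close>

lemma prob_visible_eq:
  assumes lam: "continuous_on {0..T} rateU" and mu: "continuous_on {0..T} rateV" and t: "t \<in> {0..T}"
  defines "L \<equiv> \<lambda>t. integral {0..t} rateU" and "Q \<equiv> \<lambda>t. integral {0..t} rateV"
  shows "exp (L t + Q t) * prob_visible k t =
    (\<Sum>j<k. integral {0..t} (\<lambda>\<tau>. rateU \<tau> * exp (L \<tau> + Q \<tau>) * (Q t - Q \<tau>) ^ j) / fact j)"
proof -
  define w where "w \<tau> = rateU \<tau> * exp (L \<tau> + Q \<tau>)" for \<tau>
  define J where "J j t = integral {0..t} (\<lambda>\<tau>. w \<tau> * (Q t - Q \<tau>) ^ j)" for j t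
  define G where "G k t = (\<Sum>j<k. J j t / fact j)" for k t
  have L: "(L has_real_derivative rateU t) (at t within {0..T})"
    and Q: "(Q has_real_derivative rateV t) (at t within {0..T})" if "t \<in> {0..T}" for t
    unfolding L_def Q_def using lam mu that by (auto intro: integral_has_real_derivative)
  have "continuous_on {0..T} L" "continuous_on {0..T} Q"
    using L Q by (meson DERIV_continuous continuous_on_eq_continuous_within)+
  then have w: "continuous_on {0..T} w"
    unfolding w_def by (intro continuous_intros lam)
  have J: "(J j has_real_derivative (if j = 0 then w t else real j * rateV t * J (j - 1) t)) (at t within {0..T})"
    if "t \<in> {0..T}" for j t
    unfolding J_def by (rule has_real_derivative_integral_power[OF w Q that])
  \<comment> \<open>The term \<open>j = 0\<close> yields \<open>w t\<close>; for
    \<open>j > 0\<close> the factor \<open>j\<close> cancels against \<open>fact j\<close>, and the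
    shifted sum is \<open>G k t\<close>.\<close>
  have G: "(G (Suc k) has_real_derivative w t + rateV t * G k t) (at t within {0..T})" if "t \<in> {0..T}" for k t
  proof -
    have "(G (Suc k) has_real_derivative
        (\<Sum>j<Suc k. (if j = 0 then w t else real j * rateV t * J (j - 1) t) / fact j)) (at t within {0..T})"
      unfolding G_def by (intro DERIV_sum DERIV_cdivide J that)
    also have "(\<Sum>j<Suc k. (if j = 0 then w t else real j * rateV t * J (j - 1) t) / fact j) =
        w t + (\<Sum>j<k. rateV t * (J j t / fact j))"
      by (simp add: sum.lessThan_Suc_shift del: sum.lessThan_Suc)
    finally show ?thesis
      unfolding G_def[of k t] sum_distrib_left .
  qed
  have E: "((\<lambda>t. exp (L t + Q t)) has_real_derivative (rateU t + rateV t) * exp (L t + Q t)) (at t within {0..T})"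
    if "t \<in> {0..T}" for t
    using L[OF that] Q[OF that] by (auto intro!: derivative_eq_intros)
  have at_right: "(g has_real_derivative D) (at_right t)"
    if "(g has_real_derivative D) (at t within {0..T})" "0 \<le> t" "t < T" for g D t
    using DERIV_subset[OF that(1), of "{t..T}"] that(2,3) by (simp add: at_within_Icc_at_right)
  have at_left: "(g \<longlongrightarrow> g t) (at_left t)"
    if "(g has_real_derivative D) (at t within {0..T})" "0 < t" "t \<le> T" for g D t
    using DERIV_continuous[OF DERIV_subset[OF that(1), of "{0..t}"]] that(2,3)
    by (simp add: continuous_within at_within_Icc_at_left)
  have "exp (L t + Q t) * prob_visible k t = G k t" if "t \<in> {0..T}" for t
    using that
  proof (induction k arbitrary: t)
    case 0
    show ?case
      by (simp add: G_def visible_def)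
  next
    case (Suc k)
    define \<phi> where "\<phi> t = exp (L t + Q t) * prob_visible (Suc k) t - G (Suc k) t" for t
    have "\<phi> t = \<phi> 0"
    proof (rule constant_if_right_derivative_zero[of 0 t \<phi>])
      fix x assume x: "0 < x" "x \<le> t"
      with Suc.prems have "x \<in> {0..T}" "x \<le> T" by auto
      then show "(\<phi> \<longlongrightarrow> \<phi> x) (at_left x)"
        unfolding \<phi>_def using x
        by (intro tendsto_diff tendsto_mult prob_visible_at_left at_left[OF E] at_left[OF G])
    next
      fix x assume x: "0 \<le> x" "x < t"
      with Suc.prems have "x \<in> {0..T}" "x < T" by auto
      \<comment> \<open>The derivative of the integrating factor cancels the terms
        \<open>- (rateU x + rateV x) * prob_visible (Suc k) x\<close>; the induction hypothesis then
        matches \<open>G k x\<close> with the remaining \<open>prob_visible k x\<close>.\<close>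
      have "(\<phi> has_real_derivative
          (rateU x + rateV x) * exp (L x + Q x) * prob_visible (Suc k) x +
          (rateU x * (1 - prob_visible (Suc k) x) + rateV x * (prob_visible k x - prob_visible (Suc k) x)) * exp (L x + Q x) -
          (w x + rateV x * G k x)) (at_right x)"
        unfolding \<phi>_def using x \<open>x \<in> {0..T}\<close> \<open>x < T\<close>
        by (intro DERIV_diff DERIV_mult has_real_derivative_prob_visible at_right[OF E] at_right[OF G])
      then show "(\<phi> has_real_derivative 0) (at_right x)"
        unfolding Suc.IH[OF \<open>x \<in> {0..T}\<close>, symmetric] w_def by (simp add: algebra_simps)
    qed (use Suc.prems in auto)
    moreover have "\<phi> 0 = 0"
      by (simp add: \<phi>_def G_def J_def visible_nonpos)
    ultimately show ?case
      by (simp add: \<phi>_def)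
  qed
  from this[OF t] show ?thesis
    by (simp add: G_def J_def w_def)
qed

text \<open>Writing integrals over \<open>{\<tau>..t}\<close> as differences of \<open>L\<close> and
  \<open>Q\<close> splits the exponentials. The factor \<open>exp (- (L t + Q t))\<close> leaves the
  integral and cancels the integrating factor of \<open>prob_visible_eq\<close>.\<close>

theorem visibility_formula:
  assumes lam: "continuous_on {0..T} rateU" and mu: "continuous_on {0..T} rateV"
    and mu_nonneg: "\<And>t. t \<in> {0..T} \<Longrightarrow> rateV t \<ge> 0" and t: "t \<in> {0..T}"
    and "k \<ge> 1" and boundary: "visibility M U V F k 0 = 0"
  shows "visibility M U V F k t = 1 / fact (k - 1) *
    integral {0..t} (\<lambda>\<tau>. rateU \<tau> * exp (- integral {\<tau>..t} rateU) * upper_Gamma k (integral {\<tau>..t} rateV))"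
proof -
  define L where "L = (\<lambda>t. integral {0..t} rateU)"
  define Q where "Q = (\<lambda>t. integral {0..t} rateV)"
  have diff: "integral {\<tau>..t} g = integral {0..t} g - integral {0..\<tau>} g"
    if "continuous_on {0..T} g" "\<tau> \<in> {0..t}" for \<tau> and g :: "real \<Rightarrow> real"
  proof -
    have "g integrable_on {0..t}"
      using t by (intro integrable_continuous_real continuous_on_subset[OF that(1)]) auto
    with that show ?thesis
      using Henstock_Kurzweil_Integration.integral_combine[of 0 \<tau> t g] by simp
  qed
  have integrable: "(\<lambda>\<tau>. rateU \<tau> * exp (L \<tau> + Q \<tau>) * (Q t - Q \<tau>) ^ j) integrable_on {0..t}" for j
  proof -
    have sub: "{0..t} \<subseteq> {0..T}" using t by auto
    have cont: "continuous_on {0..t} L" "continuous_on {0..t} Q"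
      unfolding L_def Q_def
      by (intro indefinite_integral_continuous_1 integrable_continuous_real continuous_on_subset[OF lam sub]
          continuous_on_subset[OF mu sub])+
    then show ?thesis
      by (intro integrable_continuous_real continuous_intros continuous_on_subset[OF lam sub])
  qed
  have "integral {0..t} (\<lambda>\<tau>. rateU \<tau> * exp (- integral {\<tau>..t} rateU) * upper_Gamma k (integral {\<tau>..t} rateV)) =
      integral {0..t} (\<lambda>\<tau>. fact (k - 1) * exp (- (L t + Q t)) *
        (\<Sum>j<k. rateU \<tau> * exp (L \<tau> + Q \<tau>) * (Q t - Q \<tau>) ^ j / fact j))"
  proof (rule integral_cong)
    fix \<tau> assume \<tau>: "\<tau> \<in> {0..t}"
    \<comment> \<open>The closed form of \<open>upper_Gamma\<close> is available for nonnegative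
      arguments.\<close>
    have "integral {\<tau>..t} rateV \<ge> 0"
      using \<tau> t mu
      by (intro integral_nonneg integrable_continuous_real continuous_on_subset[OF mu]) (auto intro: mu_nonneg)
    then show "rateU \<tau> * exp (- integral {\<tau>..t} rateU) * upper_Gamma k (integral {\<tau>..t} rateV) =
        fact (k - 1) * exp (- (L t + Q t)) *
        (\<Sum>j<k. rateU \<tau> * exp (L \<tau> + Q \<tau>) * (Q t - Q \<tau>) ^ j / fact j)"
      using upper_Gamma_eq[of "integral {\<tau>..t} rateV" k] \<open>k \<ge> 1\<close>
      by (simp add: diff[OF lam \<tau>] diff[OF mu \<tau>] L_def Q_def exp_add exp_diff exp_minus
          sum_distrib_left field_simps)
  qed
  also have "\<dots> = fact (k - 1) * exp (- (L t + Q t)) *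
      (\<Sum>j<k. integral {0..t} (\<lambda>\<tau>. rateU \<tau> * exp (L \<tau> + Q \<tau>) * (Q t - Q \<tau>) ^ j) / fact j)"
    using integrable by (simp add: integral_sum integrable_on_divide)
  also have "\<dots> = fact (k - 1) * exp (- (L t + Q t)) * (exp (L t + Q t) * prob_visible k t)"
    using prob_visible_eq[OF lam mu t, of k] by (simp add: L_def Q_def)
  also have "c * exp (- x) * (exp x * y) = c * y" for c x y :: real
    by (simp add: exp_minus)
  finally show ?thesis
    using visibility_eq_prob_visible[OF boundary] by simp
qed

end

section \<open>Smooth rates and uniqueness\<close>

lemma smooth_on_imp_continuous_on:
  assumes "smooth_on S g"
  shows "continuous_on S g"
proof -
  obtain D where D: "\<And>x. x \<in> S \<Longrightarrow> D 0 x = g x"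
    "\<And>x. x \<in> S \<Longrightarrow> (D 0 has_real_derivative D (Suc 0) x) (at x within S)"
    using assms unfolding smooth_on_def by metis
  then have "continuous_on S (D 0)"
    by (meson DERIV_continuous continuous_on_eq_continuous_within)
  with D(1) show ?thesis
    by (simp cong: continuous_on_cong)
qed

theorem lemma1:
  fixes M :: "'a measure" and T :: real and lam mu :: "real \<Rightarrow> real"
    and U V :: "'a \<Rightarrow> real set" and F :: "'a \<Rightarrow> sender stream" and k :: nat
  assumes T: "T > 0"
    and lam: "smooth_on {0..T} lam" "\<And>t. t \<in> {0..T} \<Longrightarrow> lam t \<ge> 0"
    and mu: "smooth_on {0..T} mu" "\<And>t. t \<in> {0..T} \<Longrightarrow> mu t \<ge> 0"
    and model: "follower_feed M T lam mu U V F"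
    and k: "k \<ge> 1"
    and boundary: "\<And>j. j \<in> {1..k} \<Longrightarrow> visibility M U V F j 0 = 0"
  shows "(\<forall>t\<in>{0..T}. visibility M U V F k t =
           1 / fact (k - 1) *
           integral {0..t} (\<lambda>\<tau>. lam \<tau> * exp (- integral {\<tau>..t} lam) *
                                 upper_Gamma k (integral {\<tau>..t} mu))) \<and>
         (\<forall>(M' :: 'b measure) U' V' F'.
           follower_feed M' T lam mu U' V' F' \<and>
           (\<forall>j\<in>{1..k}. visibility M' U' V' F' j 0 = 0) \<longrightarrow>
           (\<forall>t\<in>{0..T}. visibility M' U' V' F' k t = visibility M U V F k t))"
proof -
  note cont = smooth_on_imp_continuous_on[OF lam(1)] smooth_on_imp_continuous_on[OF mu(1)]
  have formula: "visibility M U V F k t = 1 / fact (k - 1) *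
      integral {0..t} (\<lambda>\<tau>. lam \<tau> * exp (- integral {\<tau>..t} lam) * upper_Gamma k (integral {\<tau>..t} mu))"
    if "t \<in> {0..T}" for t
    using k boundary[of k] that by (intro follower_feed.visibility_formula[OF model cont mu(2)]) auto
  \<comment> \<open>The right-hand side depends only on the rates, \<open>k\<close> and
    \<open>t\<close>, so any second model, possibly over another sample type, has the same
    visibility.\<close>
  have formula': "visibility M' U' V' F' k t = 1 / fact (k - 1) *
      integral {0..t} (\<lambda>\<tau>. lam \<tau> * exp (- integral {\<tau>..t} lam) * upper_Gamma k (integral {\<tau>..t} mu))"
    if "follower_feed M' T lam mu U' V' F'" "\<forall>j\<in>{1..k}. visibility M' U' V' F' j 0 = 0" "t \<in> {0..T}"
    for M' :: "'b measure" and U' V' F' t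
    using k that by (intro follower_feed.visibility_formula[OF that(1) cont mu(2)]) auto
  show ?thesis
    using formula formula' by simp
qed

end
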